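(* Let $K$ be a field, let $S\subseteq K$ be a finite subset, and let $k$ be a natural number. For every $n\in\mathbb{Z}_{\ge 0}$ define $$M_n:=\{A\in S^{n\times n}\subseteq K^{n\times n}\mid \mathrm{rk}(A)=k\},$$ the set of all rank-$k$ $n\times n$-matrices over $K$ all of whose entries are in $S$. Let $\mathrm{Sym}([n])$ act on $M_n$ by simultaneous row and column permutations. Then $|M_n/\mathrm{Sym}([n])|$ is a quasipolynomial in $n$ for $n\gg 0$; that is, there exist a quasipolynomial $f:\mathbb{Z}\to\mathbb{R}$ and an $n_0$ such that $|M_n/\mathrm{Sym}([n])|=f(n)$ for all $n\ge n_0$.
   Context: $[n]=\{1,\dots,n\}$. A quasipolynomial is a function $f:\mathbb{Z}\to\mathbb{R}$ of the form $f(n)=c_d(n)n^d+\cdots+c_0(n)$ where each $c_i:\mathbb{Z}\to\mathbb{R}$ is periodic with integral period. *)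

theory Defs
  imports
    Complex_Main
    "HOL-Algebra.Sym_Groups"
    "HOL-Algebra.Group_Action"
    "Jordan_Normal_Form.DL_Rank"
begin

definition rank_matrices :: "'a::field set \<Rightarrow> nat \<Rightarrow> nat \<Rightarrow> 'a mat set" where
  "rank_matrices S k n =
     {A \<in> carrier_mat n n. (\<forall>i<n. \<forall>j<n. A $$ (i, j) \<in> S) \<and> vec_space.rank n A = k}"

(* The left action (p . A)(i, j) = A(p^{-1} i, p^{-1} j) for i, j in {1..n}.  The symmetric group
   sym_group n permutes {1..n}, whereas matrix indices start at 0, so indices are shifted by one.
   The restriction to carrier_mat n n is the extensionality that group_action demands. *)
definition simul_perm :: "nat \<Rightarrow> (nat \<Rightarrow> nat) \<Rightarrow> 'a mat \<Rightarrow> 'a mat" where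
  "simul_perm n p = (\<lambda>A \<in> carrier_mat n n.
     mat n n (\<lambda>(i, j). A $$ (inv' p (Suc i) - 1, inv' p (Suc j) - 1)))"

lemma permutes_inv_Suc:
  assumes "p permutes {1..n}" "i < n"
  shows "inv' p (Suc i) - 1 < n" "Suc (inv' p (Suc i) - 1) = inv' p (Suc i)"
proof -
  have "inv' p (Suc i) \<in> {1..n}"
    using assms permutes_in_image[OF permutes_inv[OF assms(1)], of "Suc i"] by auto
  then show "inv' p (Suc i) - 1 < n" "Suc (inv' p (Suc i) - 1) = inv' p (Suc i)"
    by auto
qed

lemma simul_perm_comp:
  assumes p: "p permutes {1..n}" and q: "q permutes {1..n}" and A: "A \<in> carrier_mat n n"
  shows "simul_perm n (p \<circ> q) A = simul_perm n p (simul_perm n q A)"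
proof -
  have "inv' (p \<circ> q) = inv' q \<circ> inv' p"
    using p q by (simp add: o_inv_distrib permutes_bij)
  with A show ?thesis
    by (intro eq_matI) (simp_all add: simul_perm_def permutes_inv_Suc[OF p] del: One_nat_def)
qed

lemma simul_perm_id: "A \<in> carrier_mat n n \<Longrightarrow> simul_perm n id A = A"
  by (rule eq_matI) (auto simp: simul_perm_def)

lemma simul_perm_Bij:
  assumes p: "p permutes {1..n}"
  shows "simul_perm n p \<in> Bij (carrier_mat n n)"
proof -
  note ip = permutes_inv[OF p]
  have closed: "simul_perm n r A \<in> carrier_mat n n" if "A \<in> carrier_mat n n" for r and A :: "'a mat"
    using that by (simp add: simul_perm_def)
  have "bij_betw (simul_perm n p) (carrier_mat n n) (carrier_mat n n :: 'a mat set)"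
  proof (rule bij_betw_byWitness[where f' = "simul_perm n (inv' p)"])
    show "\<forall>A \<in> carrier_mat n n. simul_perm n (inv' p) (simul_perm n p A) = (A :: 'a mat)"
      using simul_perm_comp[OF ip p] simul_perm_id permutes_inv_o(2)[OF p] by metis
    show "\<forall>A \<in> carrier_mat n n. simul_perm n p (simul_perm n (inv' p) A) = (A :: 'a mat)"
      using simul_perm_comp[OF p ip] simul_perm_id permutes_inv_o(1)[OF p] by metis
  qed (use closed in auto)
  then show ?thesis by (simp add: Bij_def simul_perm_def)
qed

lemma simul_perm_group_action:
  "group_action (sym_group n) (carrier_mat n n :: 'a mat set) (simul_perm n)"
proof (intro group_action.intro group_hom.intro group_hom_axioms.intro homI)
  fix p q assume "p \<in> carrier (sym_group n)" "q \<in> carrier (sym_group n)"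
  then have p: "p permutes {1..n}" and q: "q permutes {1..n}"
    by (simp_all add: sym_group_carrier)
  have pB: "(simul_perm n p :: 'a mat \<Rightarrow> 'a mat) \<in> Bij (carrier_mat n n)"
    and qB: "(simul_perm n q :: 'a mat \<Rightarrow> 'a mat) \<in> Bij (carrier_mat n n)"
    by (rule simul_perm_Bij[OF p], rule simul_perm_Bij[OF q])
  have "(simul_perm n (p \<circ> q) :: 'a mat \<Rightarrow> 'a mat) =
        compose (carrier_mat n n) (simul_perm n p) (simul_perm n q)"
  proof
    fix A :: "'a mat"
    show "simul_perm n (p \<circ> q) A = compose (carrier_mat n n) (simul_perm n p) (simul_perm n q) A"
    proof (cases "A \<in> carrier_mat n n")
      case True
      then show ?thesis using simul_perm_comp[OF p q True] by (simp add: compose_eq)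
    next
      case False
      then show ?thesis by (simp add: compose_def simul_perm_def)
    qed
  qed
  then show "(simul_perm n (p \<otimes>\<^bsub>sym_group n\<^esub> q) :: 'a mat \<Rightarrow> 'a mat) =
        simul_perm n p \<otimes>\<^bsub>BijGroup (carrier_mat n n)\<^esub> simul_perm n q"
    using pB qB by (simp add: BijGroup_def sym_group_mult)
qed (use simul_perm_Bij in \<open>auto simp: sym_group_is_group sym_group_carrier BijGroup_def
        intro: group_BijGroup[unfolded BijGroup_def]\<close>)

definition quasipolynomial :: "(int \<Rightarrow> real) \<Rightarrow> bool" where
  "quasipolynomial f \<longleftrightarrow>
     (\<exists>(d::nat) (c :: nat \<Rightarrow> int \<Rightarrow> real).
        (\<forall>i\<le>d. \<exists>m::int. m > 0 \<and> (\<forall>n. c i (n + m) = c i n)) \<and>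
        (\<forall>n. f n = (\<Sum>i\<le>d. c i n * of_int n ^ i)))"

end

theory Submission
  imports Defs
begin

text \<open>
  Call two indices of a square matrix twins if their rows agree and their columns agree. Identifying
  twins turns an \<open>n \<times> n\<close> matrix into a twin-free one of the same rank, together with the sizes of
  the twin classes, a composition of \<open>n\<close> into positive parts. A row of a rank-\<open>k\<close> matrix
  is determined by its entries in \<open>k\<close> independent columns, so for entries in a finite set there are
  boundedly many distinct rows, hence boundedly many distinct columns, and the size \<open>m\<close> of the
  twin-free matrix is bounded independently of \<open>n\<close>. The orbits on \<open>M\<^sub>n\<close> thus correspond to
  the orbits of \<open>Sym([m])\<close>, for the finitely many possible \<open>m\<close>, on pairs of a
  twin-free matrix and a composition of \<open>n\<close> into \<open>m\<close> parts. Burnside's lemma counts the latter: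
  a permutation fixes a product set, whose first factor does not depend on \<open>n\<close>, while its second
  factor is the set of positive solutions of a linear equation with right-hand side \<open>n\<close> and
  the cycle lengths as coefficients; the number of these is eventually quasipolynomial.
\<close>

section \<open>Rank\<close>

text \<open>Scalar equations in the coordinates allow dependence to be compared between spaces of
  different dimension, as \<open>rank_blowup\<close> requires.\<close>

lemma (in vec_space) lin_dep_iff_sum:
  assumes "finite X" "X \<subseteq> carrier_vec n"
  shows "lin_dep X \<longleftrightarrow> (\<exists>a. (\<exists>v\<in>X. a v \<noteq> 0) \<and> (\<forall>i<n. (\<Sum>x\<in>X. a x * x $ i) = 0))"
proof -
  have lc: "lincomb a X = 0\<^sub>v n \<longleftrightarrow> (\<forall>i<n. (\<Sum>x\<in>X. a x * x $ i) = 0)" for a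
  proof -
    have "lincomb a X \<in> carrier_vec n"
      using assms by (intro lincomb_closed) auto
    then show ?thesis
      by (auto simp: vec_eq_iff lincomb_index[OF _ assms(2)])
  qed
  have "lin_dep X \<longleftrightarrow> (\<exists>a. (\<exists>v\<in>X. a v \<noteq> 0) \<and> lincomb a X = 0\<^sub>v n)"
    using finite_lin_dep[OF assms(1) _ assms(2)] unfolding lin_dep_def
    using assms(1) by (fastforce simp: class_ring_simps)
  then show ?thesis
    by (simp add: lc)
qed

text \<open>Repeating columns does not change the set of columns, and repeating coordinates only
  repeats the scalar equations of a linear relation. So a maximal independent set of columns of
  \<open>B\<close> is carried to one of \<open>A\<close> of the same size.\<close>

lemma rank_blowup:
  fixes A B :: "'a::field mat"
  assumes A: "A \<in> carrier_mat n n'" and B: "B \<in> carrier_mat m m'"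
    and s: "s ` {..<n} = {..<m}" and t: "t ` {..<n'} = {..<m'}"
    and AB: "\<And>i j. i < n \<Longrightarrow> j < n' \<Longrightarrow> A $$ (i, j) = B $$ (s i, t j)"
  shows "vec_space.rank n A = vec_space.rank m B"
proof -
  interpret N: vec_space "TYPE('a)" n .
  interpret M: vec_space "TYPE('a)" m .
  define \<phi> :: "'a vec \<Rightarrow> 'a vec" where "\<phi> w = vec n (\<lambda>i. w $ s i)" for w
  have slt: "s i < m" if "i < n" for i using s that by auto
  have tlt: "t i < m'" if "i < n'" for i using t that by auto
  have inj: "inj_on \<phi> (carrier_vec m)"
  proof (rule inj_onI, rule eq_vecI)
    fix v w :: "'a vec" and i
    assume vw: "v \<in> carrier_vec m" "w \<in> carrier_vec m" "\<phi> v = \<phi> w" "i < dim_vec w"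
    then have "i \<in> s ` {..<n}" using s by auto
    then obtain j where "j < n" "i = s j" by auto
    then show "v $ i = w $ i" using arg_cong[OF vw(3), of "\<lambda>u. u $ j"] by (simp add: \<phi>_def)
  qed auto
  have colA: "col A j = \<phi> (col B (t j))" if "j < n'" for j
    using A B that AB slt tlt by (intro eq_vecI) (auto simp: \<phi>_def)
  have cols_image: "set (cols A) = \<phi> ` set (cols B)"
  proof -
    have "set (cols A) = (\<lambda>j. \<phi> (col B (t j))) ` {..<n'}"
      using A colA by (force simp: cols_def)
    also have "\<dots> = \<phi> ` (col B ` (t ` {..<n'}))"
      by (simp add: image_image)
    also have "\<dots> = \<phi> ` set (cols B)"
      using B unfolding t by (auto simp: cols_def)
    finally show ?thesis .
  qed
  have Bcar: "set (cols B) \<subseteq> carrier_vec m"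
    using B cols_dim by blast
  have dep: "N.lin_dep (\<phi> ` T) \<longleftrightarrow> M.lin_dep T" if T: "T \<subseteq> set (cols B)" for T
  proof -
    have fT: "finite T" using T finite_subset by blast
    have Tc: "T \<subseteq> carrier_vec m" using T Bcar by blast
    have injT: "inj_on \<phi> T" using inj Tc by (rule inj_on_subset)
    have \<phi>c: "\<phi> ` T \<subseteq> carrier_vec n" by (auto simp: \<phi>_def)
    \<comment> \<open>Since \<open>s\<close> is onto, the equations for \<open>i < n\<close> are
      those for the coordinates below \<open>m\<close>, some of them repeated.\<close>
    have sums: "(\<forall>i<n. (\<Sum>x\<in>\<phi> ` T. a x * x $ i) = 0) \<longleftrightarrow> (\<forall>i<m. (\<Sum>x\<in>T. a (\<phi> x) * x $ i) = 0)"
      for a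
    proof -
      have "(\<Sum>x\<in>\<phi> ` T. a x * x $ i) = (\<Sum>x\<in>T. a (\<phi> x) * x $ s i)" if "i < n" for i
        by (subst sum.reindex[OF injT]) (simp add: \<phi>_def that)
      moreover have "(\<forall>i<m. P i) \<longleftrightarrow> (\<forall>i<n. P (s i))" for P
        using s by (metis image_iff lessThan_iff)
      ultimately show ?thesis by simp
    qed
    have "N.lin_dep (\<phi> ` T) \<longleftrightarrow>
      (\<exists>a. (\<exists>v\<in>T. a (\<phi> v) \<noteq> 0) \<and> (\<forall>i<m. (\<Sum>x\<in>T. a (\<phi> x) * x $ i) = 0))"
      unfolding N.lin_dep_iff_sum[OF finite_imageI[OF fT] \<phi>c] sums by simp
    also have "\<dots> \<longleftrightarrow> (\<exists>b. (\<exists>v\<in>T. b v \<noteq> 0) \<and> (\<forall>i<m. (\<Sum>x\<in>T. b x * x $ i) = 0))"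
    proof (intro iffI; elim exE)
      fix b assume b: "(\<exists>v\<in>T. b v \<noteq> 0) \<and> (\<forall>i<m. (\<Sum>x\<in>T. b x * x $ i) = 0)"
      then show "\<exists>a. (\<exists>v\<in>T. a (\<phi> v) \<noteq> 0) \<and> (\<forall>i<m. (\<Sum>x\<in>T. a (\<phi> x) * x $ i) = 0)"
        using injT by (intro exI[of _ "b \<circ> the_inv_into T \<phi>"]) (simp add: the_inv_into_f_f)
    qed auto
    also have "\<dots> \<longleftrightarrow> M.lin_dep T"
      by (rule M.lin_dep_iff_sum[OF fT Tc, symmetric])
    finally show ?thesis .
  qed
  have "M.lin_indpt {}"
    by (simp add: M.lin_dep_iff_sum)
  then obtain U where U: "maximal U (\<lambda>T. T \<subseteq> set (cols B) \<and> M.lin_indpt T)"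
    using maximal_exists_superset[of "set (cols B)" "\<lambda>T. T \<subseteq> set (cols B) \<and> M.lin_indpt T" "{}"]
    by auto
  then have Usub: "U \<subseteq> set (cols B)" and Uind: "M.lin_indpt U"
    by (auto simp: maximal_def)
  have "maximal (\<phi> ` U) (\<lambda>T. T \<subseteq> set (cols A) \<and> N.lin_indpt T)"
    unfolding maximal_def
  proof (intro conjI allI impI)
    show "\<phi> ` U \<subseteq> set (cols A)" using Usub cols_image by auto
    show "N.lin_indpt (\<phi> ` U)" using dep[OF Usub] Uind by simp
    fix T' assume T': "\<phi> ` U \<subseteq> T' \<and> T' \<subseteq> set (cols A) \<and> N.lin_indpt T'"
    then obtain T where T: "T \<subseteq> set (cols B)" "T' = \<phi> ` T"
      unfolding cols_image by (auto simp: subset_image_iff)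
    \<comment> \<open>Injectivity of \<open>\<phi>\<close> pulls the inclusion of images back, so
      that maximality of \<open>U\<close> applies to \<open>T\<close>.\<close>
    have "U \<subseteq> T"
    proof
      fix u assume u: "u \<in> U"
      then obtain v where v: "v \<in> T" "\<phi> u = \<phi> v" using T' T by blast
      then have "u = v" using u Usub T Bcar inj_onD[OF inj, of u v] by blast
      then show "u \<in> T" using v by simp
    qed
    moreover have "M.lin_indpt T" using T' T dep by simp
    ultimately have "T = U"
      using U T(1) by (simp add: maximal_def)
    then show "T' = \<phi> ` U"
      using T(2) by simp
  qed
  then have "N.rank A = card (\<phi> ` U)" by (rule N.rank_card_indpt[OF A])
  also have "\<dots> = card U"
    using Usub Bcar by (intro card_image inj_on_subset[OF inj]) auto
  also have "\<dots> = M.rank B" using M.rank_card_indpt[OF B U] by simp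
  finally show ?thesis .
qed

section \<open>Bounding the numbers of distinct rows and columns\<close>

lemma card_image_le_card_image:
  assumes "finite A" and "\<And>x y. x \<in> A \<Longrightarrow> y \<in> A \<Longrightarrow> g x = g y \<Longrightarrow> f x = f y"
  shows "card (f ` A) \<le> card (g ` A)"
proof -
  have "f (inv_into A g (g x)) = f x" if "x \<in> A" for x
  proof (rule assms(2))
    show "inv_into A g (g x) \<in> A" "g (inv_into A g (g x)) = g x"
      using that by (simp_all add: inv_into_into f_inv_into_f)
  qed (rule that)
  then have "f ` A = (\<lambda>y. f (inv_into A g y)) ` (g ` A)"
    unfolding image_image by (intro image_cong) auto
  moreover have "card ((\<lambda>y. f (inv_into A g y)) ` (g ` A)) \<le> card (g ` A)"
    using assms(1) by (intro card_image_le) simp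
  ultimately show ?thesis by simp
qed

text \<open>A maximal independent set of columns spans all columns, so a row is determined by its
  entries in these columns. Their number is the rank, and each entry takes at most
  \<open>card S\<close> values.\<close>

lemma card_rows_le_power_rank:
  fixes A :: "'a::field mat"
  assumes A: "A \<in> carrier_mat n n'" and finS: "finite S"
    and entries: "\<And>i j. i < n \<Longrightarrow> j < n' \<Longrightarrow> A $$ (i, j) \<in> S"
  shows "card (row A ` {..<n}) \<le> card S ^ vec_space.rank n A"
proof -
  interpret vec_space "TYPE('a)" n .
  have "lin_indpt {}"
    by (simp add: lin_dep_iff_sum)
  then obtain U where U: "maximal U (\<lambda>T. T \<subseteq> set (cols A) \<and> lin_indpt T)"
    using maximal_exists_superset[of "set (cols A)" "\<lambda>T. T \<subseteq> set (cols A) \<and> lin_indpt T" "{}"]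
    by auto
  then have Usub: "U \<subseteq> set (cols A)" and Uind: "lin_indpt U"
    by (auto simp: maximal_def)
  have finU: "finite U" using Usub finite_subset by blast
  have Acar: "set (cols A) \<subseteq> carrier_vec n" using A cols_dim by blast
  then have Ucar: "U \<subseteq> carrier_vec n" using Usub by blast
  have in_span: "c \<in> span U" if c: "c \<in> set (cols A)" for c
  proof (cases "c \<in> U")
    case True
    then show ?thesis using in_own_span[OF Ucar] by blast
  next
    case False
    then have "lin_dep (U \<union> {c})"
      using U c unfolding maximal_def by blast
    then show ?thesis
      using lin_dep_iff_in_span[of U c] Ucar Uind c Acar False by auto
  qed
  \<comment> \<open>Every column is a linear combination of \<open>U\<close>, so it takes equal
    values at \<open>i\<close> and \<open>i'\<close> once all vectors of \<open>U\<close>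
    do.\<close>
  have agree: "row A i = row A i'"
    if i: "i < n" "i' < n" and eq: "\<And>u. u \<in> U \<Longrightarrow> u $ i = u $ i'" for i i'
  proof (rule eq_vecI)
    fix j assume "j < dim_vec (row A i')"
    then have j: "j < n'" using A by simp
    then have "col A j \<in> set (cols A)" using A by (auto simp: cols_def)
    from finite_in_span[OF finU Ucar in_span[OF this]]
    obtain a where a: "lincomb a U = col A j"
      by auto
    have "col A j $ i = col A j $ i'"
      unfolding a[symmetric] lincomb_index[OF i(1) Ucar] lincomb_index[OF i(2) Ucar] using eq by simp
    then show "row A i $ j = row A i' $ j"
      using A i j by simp
  qed simp
  let ?g = "\<lambda>i. \<lambda>u\<in>U. u $ i"
  have "card (row A ` {..<n}) \<le> card (?g ` {..<n})"
  proof (rule card_image_le_card_image)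
    fix i i' assume i: "i \<in> {..<n}" "i' \<in> {..<n}" and eq: "?g i = ?g i'"
    have "u $ i = u $ i'" if "u \<in> U" for u
      using fun_cong[OF eq, of u] that by simp
    then show "row A i = row A i'"
      using i by (intro agree) simp_all
  qed simp
  also have "\<dots> \<le> card (U \<rightarrow>\<^sub>E S)"
  proof (rule card_mono)
    show "finite (U \<rightarrow>\<^sub>E S)" using finU finS by (simp add: finite_PiE)
    have "u $ i \<in> S" if "u \<in> U" "i < n" for u i
    proof -
      have "u \<in> set (cols A)" using that Usub by blast
      then obtain j where "j < n'" "u = col A j" using A by (auto simp: cols_def)
      then show ?thesis using A that entries by simp
    qed
    then show "?g ` {..<n} \<subseteq> U \<rightarrow>\<^sub>E S" by auto
  qed
  also have "\<dots> = card S ^ rank A"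
    using rank_card_indpt[OF A U] by (simp add: card_funcsetE[OF finU])
  finally show ?thesis .
qed

text \<open>A column is determined by its entries in one copy of each distinct row, that is, by a
  function from the set of rows to \<open>S\<close>.\<close>

lemma card_cols_le_power_rows:
  assumes A: "A \<in> carrier_mat n n'" and finS: "finite S"
    and entries: "\<And>i j. i < n \<Longrightarrow> j < n' \<Longrightarrow> A $$ (i, j) \<in> S"
  shows "card (col A ` {..<n'}) \<le> card S ^ card (row A ` {..<n})"
proof -
  let ?R = "row A ` {..<n}"
  let ?g = "\<lambda>j. \<lambda>r\<in>?R. r $ j"
  have "card (col A ` {..<n'}) \<le> card (?g ` {..<n'})"
  proof (rule card_image_le_card_image)
    fix j j' assume j: "j \<in> {..<n'}" "j' \<in> {..<n'}" and eq: "?g j = ?g j'"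
    have "A $$ (i, j) = A $$ (i, j')" if "i < n" for i
      using fun_cong[OF eq, of "row A i"] that j A by simp
    then show "col A j = col A j'"
      using A j by (intro eq_vecI) auto
  qed simp
  also have "\<dots> \<le> card (?R \<rightarrow>\<^sub>E S)"
    using A entries finS by (intro card_mono) (auto simp: finite_PiE)
  also have "\<dots> = card S ^ card ?R"
    by (simp add: card_funcsetE)
  finally show ?thesis .
qed

section \<open>Quasipolynomials\<close>

text \<open>By strong induction: \<open>(x + M) ^ Suc d - x ^ Suc d\<close> is a nonzero multiple of
  \<open>x ^ d\<close> plus lower powers, whose antidifferences are already available.\<close>

lemma poly_antidifference_monom:
  fixes M :: real
  assumes "M \<noteq> 0"
  shows "\<exists>P. \<forall>x. poly P (x + M) - poly P x = x ^ d"
proof (induction d rule: less_induct)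
  case (less d)
  then obtain Q where Q: "\<And>i x. i < d \<Longrightarrow> poly (Q i) (x + M) - poly (Q i) x = x ^ i"
    by metis
  let ?c = "\<lambda>i. real (Suc d choose i) * M ^ (Suc d - i)"
  have c: "?c d = real (Suc d) * M" by simp
  let ?P = "Polynomial.smult (1 / ?c d) (monom 1 (Suc d) - (\<Sum>i<d. Polynomial.smult (?c i) (Q i)))"
  have "poly ?P (x + M) - poly ?P x = x ^ d" for x
  proof -
    have "(x + M) ^ Suc d - x ^ Suc d = (\<Sum>i<d. ?c i * x ^ i) + ?c d * x ^ d"
      unfolding binomial_ring by (simp add: lessThan_Suc_atMost[symmetric] algebra_simps)
    moreover have "(\<Sum>i<d. ?c i * x ^ i) =
        (\<Sum>i<d. ?c i * poly (Q i) (x + M)) - (\<Sum>i<d. ?c i * poly (Q i) x)"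
      unfolding sum_subtractf[symmetric] right_diff_distrib[symmetric] using Q by simp
    ultimately have "((x + M) ^ Suc d - (\<Sum>i<d. ?c i * poly (Q i) (x + M))) -
        (x ^ Suc d - (\<Sum>i<d. ?c i * poly (Q i) x)) = ?c d * x ^ d"
      by linarith
    moreover have P: "poly ?P y = (y ^ Suc d - (\<Sum>i<d. ?c i * poly (Q i) y)) / ?c d" for y
      by (simp add: poly_sum poly_monom del: power_Suc)
    moreover have "?c d \<noteq> 0" unfolding c using assms by simp
    ultimately show ?thesis
      unfolding P diff_divide_distrib[symmetric] by simp
  qed
  then show ?case by blast
qed

lemma poly_antidifference:
  fixes M :: real and p :: "real poly"
  assumes "M \<noteq> 0"
  shows "\<exists>P. \<forall>x. poly P (x + M) - poly P x = poly p x"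
proof -
  obtain Q where Q: "\<And>d x. poly (Q d) (x + M) - poly (Q d) x = x ^ d"
    using poly_antidifference_monom[OF assms] by metis
  let ?P = "\<Sum>i\<le>degree p. Polynomial.smult (coeff p i) (Q i)"
  have "poly ?P (x + M) - poly ?P x = poly p x" for x
    by (simp add: poly_sum sum_subtractf[symmetric] right_diff_distrib[symmetric] Q
        poly_altdef[of p])
  then show ?thesis by blast
qed

section \<open>Eventually quasipolynomial functions\<close>

text \<open>Instead of periodic coefficients, each residue class modulo the period carries its own
  polynomial; the formula may fail for finitely many \<open>n\<close>.\<close>
definition eventually_quasipoly :: "(nat \<Rightarrow> real) \<Rightarrow> bool" where
  "eventually_quasipoly q \<longleftrightarrow>
     (\<exists>M>0. \<exists>p. \<forall>\<^sub>F n in sequentially. q n = poly (p (n mod M)) (real n))"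

lemma eventually_quasipolyI:
  "M > 0 \<Longrightarrow> (\<And>n. n \<ge> N \<Longrightarrow> q n = poly (p (n mod M)) (real n)) \<Longrightarrow> eventually_quasipoly q"
  unfolding eventually_quasipoly_def eventually_sequentially by blast

text \<open>Brings two such functions to the common period \<open>M * M'\<close> before their
  polynomials are added.\<close>

lemma eventually_quasipoly_change_period:
  assumes "\<forall>\<^sub>F n in sequentially. q n = poly (p (n mod M)) (real n)" "M dvd M'"
  shows "\<forall>\<^sub>F n in sequentially. q n = poly (p (n mod M' mod M)) (real n)"
  using assms by (simp add: mod_mod_cancel)

lemma eventually_quasipoly_0: "eventually_quasipoly (\<lambda>_. 0)"
  by (rule eventually_quasipolyI[of 1 0 _ "\<lambda>_. 0"]) auto

lemma eventually_quasipoly_cong: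
  assumes "eventually_quasipoly q" "\<forall>\<^sub>F n in sequentially. q' n = q n"
  shows "eventually_quasipoly q'"
proof -
  obtain M p where "M > 0" "\<forall>\<^sub>F n in sequentially. q n = poly (p (n mod M)) (real n)"
    using assms(1) unfolding eventually_quasipoly_def by blast
  from this(2) assms(2) have "\<forall>\<^sub>F n in sequentially. q' n = poly (p (n mod M)) (real n)"
    by eventually_elim simp
  with \<open>M > 0\<close> show ?thesis unfolding eventually_quasipoly_def by blast
qed

lemma eventually_quasipoly_add:
  assumes "eventually_quasipoly q" "eventually_quasipoly r"
  shows "eventually_quasipoly (\<lambda>n. q n + r n)"
proof -
  obtain M p where M: "M > 0" "\<forall>\<^sub>F n in sequentially. q n = poly (p (n mod M)) (real n)"
    using assms(1) unfolding eventually_quasipoly_def by blast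
  obtain M' p' where M': "M' > 0" "\<forall>\<^sub>F n in sequentially. r n = poly (p' (n mod M')) (real n)"
    using assms(2) unfolding eventually_quasipoly_def by blast
  have "\<forall>\<^sub>F n in sequentially. q n + r n =
      poly (p (n mod (M * M') mod M) + p' (n mod (M * M') mod M')) (real n)"
    using eventually_quasipoly_change_period[OF M(2), of "M * M'"]
      eventually_quasipoly_change_period[OF M'(2), of "M * M'"]
    by (rule eventually_elim2) auto
  with M(1) M'(1) show ?thesis
    unfolding eventually_quasipoly_def
    by (intro exI[of _ "M * M'"] conjI exI[of _ "\<lambda>a. p (a mod M) + p' (a mod M')"]) auto
qed

lemma eventually_quasipoly_cmult:
  assumes "eventually_quasipoly q"
  shows "eventually_quasipoly (\<lambda>n. c * q n)"
proof -
  obtain M p where M: "M > 0" "\<forall>\<^sub>F n in sequentially. q n = poly (p (n mod M)) (real n)"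
    using assms(1) unfolding eventually_quasipoly_def by blast
  from M(2) have "\<forall>\<^sub>F n in sequentially. c * q n = poly (Polynomial.smult c (p (n mod M))) (real n)"
    by eventually_elim simp
  with M(1) show ?thesis
    unfolding eventually_quasipoly_def
    by (intro exI[of _ M] conjI exI[of _ "\<lambda>a. Polynomial.smult c (p a)"]) auto
qed

lemma eventually_quasipoly_sum:
  assumes "\<And>i. i \<in> I \<Longrightarrow> eventually_quasipoly (q i)"
  shows "eventually_quasipoly (\<lambda>n. \<Sum>i\<in>I. q i n)"
  using assms
  by (induction I rule: infinite_finite_induct)
    (auto intro: eventually_quasipoly_0 eventually_quasipoly_add)

text \<open>If \<open>q\<close> has period \<open>M\<close>, then \<open>M\<close> consecutive
  recurrences combine to one with step \<open>M * w\<close>, a multiple of that period. Along a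
  residue class modulo this step the increments are values of a single polynomial, and a polynomial
  antidifference recovers \<open>r\<close> up to a constant.\<close>

lemma eventually_quasipoly_antidifference:
  assumes q: "eventually_quasipoly q" and w: "w > 0"
    and rec: "\<forall>\<^sub>F n in sequentially. r (n + w) = r n + q n"
  shows "eventually_quasipoly r"
proof -
  obtain M p where M: "M > 0"
    and ev: "\<forall>\<^sub>F n in sequentially. q n = poly (p (n mod M)) (real n)"
    using q unfolding eventually_quasipoly_def by blast
  from ev rec have "\<forall>\<^sub>F n in sequentially. q n = poly (p (n mod M)) (real n) \<and> r (n + w) = r n + q n"
    by eventually_elim simp
  then obtain N where N: "q n = poly (p (n mod M)) (real n)" "r (n + w) = r n + q n" if "n \<ge> N" for n
    unfolding eventually_sequentially by blast
  define L where "L = M * w"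
  have L: "L > 0" using M w by (simp add: L_def)
  have steps: "r (n + k * w) = r n + (\<Sum>j<k. q (n + j * w))" if "n \<ge> N" for n k
  proof (induction k)
    case (Suc k)
    have "r (n + Suc k * w) = r (n + k * w) + q (n + k * w)"
      using N(2)[of "n + k * w"] that by (simp add: algebra_simps)
    with Suc show ?case by simp
  qed simp
  \<comment> \<open>\<open>g a\<close> adds the \<open>M\<close> increments of one long step as a
    polynomial in the starting point; \<open>pcompose\<close> shifts the argument by
    \<open>j * w\<close>.\<close>
  define g where "g a = (\<Sum>j<M. pcompose (p ((a + j * w) mod M)) [:real (j * w), 1:])" for a
  have step: "r (n + L) = r n + poly (g (n mod L)) (real n)" if "n \<ge> N" for n
  proof -
    have "q (n + j * w) = poly (pcompose (p ((n mod L + j * w) mod M)) [:real (j * w), 1:]) (real n)"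
      for j
    proof -
      have "(n mod L + j * w) mod M = (n + j * w) mod M"
        unfolding L_def by (metis dvd_triv_left mod_add_left_eq mod_mod_cancel)
      then show ?thesis
        using N(1)[of "n + j * w"] that by (simp add: poly_pcompose add_ac)
    qed
    then show ?thesis
      using steps[OF that, of M] by (simp add: L_def g_def poly_sum)
  qed
  obtain P where P: "\<And>a x. poly (P a) (x + real L) - poly (P a) x = poly (g a) x"
    using poly_antidifference[of "real L" "g _"] L by (metis less_not_refl of_nat_0_eq_iff)
  \<comment> \<open>The constant makes \<open>R a\<close> agree with \<open>r\<close> at
    \<open>N * L + a\<close>, the base case of the induction along the class. Starting at
    \<open>N * L\<close> stays in the range where the recurrence holds.\<close>
  define R where "R a = P a + [: r (N * L + a) - poly (P a) (real (N * L + a)) :]" for a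
  have residue_class: "r (N * L + a + t * L) = poly (R a) (real (N * L + a + t * L))" if "a < L" for a t
  proof (induction t)
    case (Suc t)
    let ?n = "N * L + a + t * L"
    have "N \<le> N * L" using L by simp
    then have "?n \<ge> N" by linarith
    moreover have "?n mod L = a" using that by simp
    ultimately have "r (?n + L) = r ?n + poly (g a) (real ?n)"
      using step[of ?n] by simp
    then show ?case
      using Suc P[of a "real ?n"] by (simp add: R_def algebra_simps)
  qed (simp add: R_def)
  show ?thesis
  proof (rule eventually_quasipolyI[OF L])
    fix n assume n: "n \<ge> N * L"
    have "n div L \<ge> N" using n L by (simp add: less_eq_div_iff_mult_less_eq)
    then have "N * L + n mod L + (n div L - N) * L = n"
      by (metis (no_types, lifting) add.commute add.left_commute add_diff_inverse_nat add_mult_distrib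
          div_mult_mod_eq linorder_not_le)
    then show "r n = poly (R (n mod L)) (real n)"
      using residue_class[of "n mod L" "n div L - N"] L by simp
  qed
qed

text \<open>The \<open>i\<close>-th coefficient of the polynomial attached to the residue of
  \<open>n\<close> is periodic in \<open>n\<close>. One bound \<open>d\<close> serves for the
  degrees in all residue classes, since higher coefficients vanish.\<close>

lemma eventually_quasipoly_imp_quasipolynomial:
  assumes "eventually_quasipoly q"
  shows "\<exists>f n\<^sub>0. quasipolynomial f \<and> (\<forall>n\<ge>n\<^sub>0. q n = f (int n))"
proof -
  obtain M p N where M: "M > 0" and N: "\<And>n. n \<ge> N \<Longrightarrow> q n = poly (p (n mod M)) (real n)"
    using assms unfolding eventually_quasipoly_def eventually_sequentially by blast
  define d where "d = Max ((\<lambda>a. degree (p a)) ` {..<M})"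
  define c where "c i n = coeff (p (nat (n mod int M))) i" for i and n :: int
  define f where "f n = (\<Sum>i\<le>d. c i n * of_int n ^ i)" for n :: int
  have "quasipolynomial f"
    unfolding quasipolynomial_def
  proof (intro exI conjI allI impI)
    show "int M > 0" using M by simp
    show "c i (n + int M) = c i n" for i n by (simp add: c_def)
  qed (simp add: f_def)
  moreover have "q n = f (int n)" if "n \<ge> N" for n
  proof -
    let ?p = "p (n mod M)"
    have deg: "degree ?p \<le> d"
      unfolding d_def using M by (intro Max_ge) auto
    have "q n = (\<Sum>i\<le>degree ?p. coeff ?p i * real n ^ i)"
      using N[OF that] by (simp add: poly_altdef)
    also have "\<dots> = (\<Sum>i\<le>d. coeff ?p i * real n ^ i)"
      using deg by (intro sum.mono_neutral_left) (auto intro: coeff_eq_0)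
    also have "\<dots> = f (int n)"
      by (simp add: f_def c_def zmod_int[symmetric])
    finally show ?thesis .
  qed
  ultimately show ?thesis by blast
qed

section \<open>Counting positive solutions of a linear equation\<close>

definition positive_solutions :: "'j set \<Rightarrow> ('j \<Rightarrow> nat) \<Rightarrow> nat \<Rightarrow> ('j \<Rightarrow> nat) set" where
  "positive_solutions J w n = {g \<in> J \<rightarrow>\<^sub>E {1..}. (\<Sum>j\<in>J. w j * g j) = n}"

lemma finite_positive_solutions:
  assumes "finite J" "\<And>j. j \<in> J \<Longrightarrow> w j > 0"
  shows "finite (positive_solutions J w n)"
proof (rule finite_subset)
  show "positive_solutions J w n \<subseteq> J \<rightarrow>\<^sub>E {..n}"
  proof
    fix g assume g: "g \<in> positive_solutions J w n"
    have "g j \<le> n" if "j \<in> J" for j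
    proof -
      have "g j \<le> w j * g j" using assms(2)[OF that] by simp
      also have "\<dots> \<le> (\<Sum>j\<in>J. w j * g j)"
        using that assms(1) by (intro member_le_sum) auto
      finally show ?thesis using g by (simp add: positive_solutions_def)
    qed
    then show "g \<in> J \<rightarrow>\<^sub>E {..n}"
      using g by (auto simp: positive_solutions_def)
  qed
qed (use assms(1) in \<open>simp add: finite_PiE\<close>)

text \<open>The solutions with value 1 at the new unknown come from \<open>J\<close>; all others arise by
  incrementing that value.\<close>
lemma card_positive_solutions_insert:
  assumes J: "finite J" "j \<notin> J" and w: "\<And>i. i \<in> insert j J \<Longrightarrow> w i > 0"
  shows "card (positive_solutions (insert j J) w (n + w j)) =
    card (positive_solutions (insert j J) w n) + card (positive_solutions J w n)"
proof -
  let ?inc = "\<lambda>g. g(j := Suc (g j))" and ?one = "\<lambda>g. g(j := Suc 0)"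
  let ?X = "positive_solutions (insert j J) w" and ?Y = "positive_solutions J w n"
  have upd: "(\<Sum>i\<in>J. w i * (g(j := a)) i) = (\<Sum>i\<in>J. w i * g i)" for g a
    using J(2) by (intro sum.cong) auto
  have eq: "?X (n + w j) = ?inc ` ?X n \<union> ?one ` ?Y"
  proof (intro equalityI subsetI)
    fix g assume g: "g \<in> ?X (n + w j)"
    then have pos: "g j \<ge> 1" by (auto simp: positive_solutions_def)
    show "g \<in> ?inc ` ?X n \<union> ?one ` ?Y"
    proof (cases "g j = 1")
      case True
      \<comment> \<open>The value \<open>undefined\<close> at \<open>j\<close> makes the function
        extensional on \<open>J\<close>.\<close>
      have "g(j := undefined) \<in> ?Y"
        using g True J unfolding positive_solutions_def
        by (auto simp: upd PiE_iff extensional_def simp del: fun_upd_apply) (auto split: if_splits)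
      moreover have "g = ?one (g(j := undefined))" using True by auto
      ultimately show ?thesis by blast
    next
      case False
      with pos obtain a where a: "g j = Suc (Suc a)"
        by (metis One_nat_def not0_implies_Suc not_one_le_zero)
      have "g(j := Suc a) \<in> ?X n"
        using g a J unfolding positive_solutions_def
        by (auto simp: upd PiE_iff extensional_def simp del: fun_upd_apply) (auto split: if_splits)
      moreover have "g = ?inc (g(j := Suc a))" using a by auto
      ultimately show ?thesis by blast
    qed
  next
    fix g assume "g \<in> ?inc ` ?X n \<union> ?one ` ?Y"
    then show "g \<in> ?X (n + w j)"
    proof
      assume "g \<in> ?inc ` ?X n"
      then show ?thesis
        using J unfolding positive_solutions_def
        by (auto simp: upd PiE_iff extensional_def simp del: fun_upd_apply) (auto split: if_splits)
    next
      assume "g \<in> ?one ` ?Y"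
      then show ?thesis
        using J unfolding positive_solutions_def
        by (auto simp: upd PiE_iff extensional_def simp del: fun_upd_apply) (auto split: if_splits)
    qed
  qed
  have "inj_on ?inc (?X n)"
  proof (rule inj_onI, rule ext)
    fix g h i assume "?inc g = ?inc h"
    from fun_cong[OF this, of i] show "g i = h i" by (simp split: if_splits)
  qed
  moreover have "inj_on ?one ?Y"
  proof (rule inj_onI, rule ext)
    fix g h i assume gh: "g \<in> ?Y" "h \<in> ?Y" "?one g = ?one h"
    \<comment> \<open>\<open>?one\<close> overwrites the value at \<open>j\<close>, but
      extensionality on \<open>J\<close> has fixed that value.\<close>
    then have "g j = undefined" "h j = undefined"
      using J(2) by (auto simp: positive_solutions_def PiE_iff extensional_def)
    then show "g i = h i"
      using fun_cong[OF gh(3), of i] by (cases "i = j") auto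
  qed
  moreover have "?inc ` ?X n \<inter> ?one ` ?Y = {}"
  proof -
    \<comment> \<open>Incremented solutions have a value of at least 2 at \<open>j\<close>, the
      others have 1.\<close>
    have "g j \<ge> 1" if "g \<in> ?X n" for g using that by (auto simp: positive_solutions_def)
    then show ?thesis
      by (force dest!: fun_cong[of _ _ j])
  qed
  moreover have "finite (?X n)" "finite ?Y"
    using J(1) w by (auto intro!: finite_positive_solutions)
  ultimately show ?thesis
    unfolding eq by (simp add: card_Un_disjoint card_image)
qed

text \<open>A new unknown \<open>j\<close> leads to a recurrence with step \<open>w j\<close> whose
  increment is the count without \<open>j\<close>, so induction over \<open>J\<close> reduces
  everything to antidifferences.\<close>

lemma eventually_quasipoly_card_positive_solutions:
  assumes "finite J" "\<And>j. j \<in> J \<Longrightarrow> w j > 0"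
  shows "eventually_quasipoly (\<lambda>n. real (card (positive_solutions J w n)))"
  using assms
proof (induction J)
  case empty
  \<comment> \<open>Without unknowns the sum is 0, so there is a solution only for
    \<open>n = 0\<close>.\<close>
  have "\<forall>\<^sub>F n in sequentially. real (card (positive_solutions {} w n)) = 0"
    using eventually_gt_at_top[of 0] by eventually_elim (simp add: positive_solutions_def)
  then show ?case
    by (rule eventually_quasipoly_cong[OF eventually_quasipoly_0])
next
  case (insert j J)
  have "eventually_quasipoly (\<lambda>n. real (card (positive_solutions J w n)))"
    using insert by simp
  then show ?case
  proof (rule eventually_quasipoly_antidifference[of _ "w j"])
    show "\<forall>\<^sub>F n in sequentially. real (card (positive_solutions (insert j J) w (n + w j))) =
      real (card (positive_solutions (insert j J) w n)) + real (card (positive_solutions J w n))"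
      using card_positive_solutions_insert[of J j w, OF insert.hyps(1,2) insert.prems]
      by (intro always_eventually allI) simp
  qed (use insert.prems in simp)
qed

text \<open>An invariant function is a free choice of a positive value on each class of indices that
  invariant functions cannot separate; for a permutation \<open>q\<close> these classes are the
  cycles. The sum becomes a linear form with the class sizes as coefficients.\<close>

lemma eventually_quasipoly_card_invariant_compositions:
  assumes I: "finite I" and q: "q \<in> I \<rightarrow> I"
  shows "eventually_quasipoly (\<lambda>n. real (card
    {f \<in> I \<rightarrow>\<^sub>E {1..}. (\<forall>i\<in>I. f (q i) = f i) \<and> (\<Sum>i\<in>I. f i) = (n::nat)}))"
proof -
  define F where "F = {f \<in> I \<rightarrow>\<^sub>E {1::nat..}. \<forall>i\<in>I. f (q i) = f i}"
  \<comment> \<open>With classes defined through the invariant functions themselves, constancy on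
    classes and \<open>h (q i) = h i\<close> are immediate, without following cycles.\<close>
  define h where "h i = {j \<in> I. \<forall>f\<in>F. f i = f j}" for i
  define w where "w c = card {i \<in> I. h i = c}" for c
  have hI: "h i = h i' \<Longrightarrow> f i = f i'" if "i \<in> I" "i' \<in> I" "f \<in> F" for i i' f
    using that unfolding h_def by auto
  have hq: "h (q i) = h i" if "i \<in> I" for i
    using that unfolding h_def F_def by auto
  have card_eq: "card {f \<in> I \<rightarrow>\<^sub>E {1..}. (\<forall>i\<in>I. f (q i) = f i) \<and> (\<Sum>i\<in>I. f i) = n} =
    card (positive_solutions (h ` I) w n)" for n
  proof (rule bij_betw_same_card[symmetric])
    have sum: "(\<Sum>i\<in>I. g (h i)) = (\<Sum>c\<in>h ` I. w c * g c)" for g :: "'a set \<Rightarrow> nat"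
      using sum_fun_comp[of I "h ` I" h g] I by (simp add: w_def)
    \<comment> \<open>\<open>?desc\<close> reads a value off at a chosen representative of the
      class; \<open>frep\<close> shows that the choice does not matter.\<close>
    let ?lift = "\<lambda>g. \<lambda>i\<in>I. g (h i)" and ?desc = "\<lambda>f. \<lambda>c\<in>h ` I. f (inv_into I h c)"
    have rep: "inv_into I h (h i) \<in> I" "h (inv_into I h (h i)) = h i" if "i \<in> I" for i
      using that by (simp_all add: inv_into_into f_inv_into_f)
    have frep: "f (inv_into I h (h i)) = f i" if "i \<in> I" "f \<in> F" for f i
      using hI[of "inv_into I h (h i)" i f] rep that by blast
    show "bij_betw ?lift (positive_solutions (h ` I) w n)
      {f \<in> I \<rightarrow>\<^sub>E {1..}. (\<forall>i\<in>I. f (q i) = f i) \<and> (\<Sum>i\<in>I. f i) = n}"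
    proof (rule bij_betw_byWitness[where f' = ?desc])
      show "\<forall>g\<in>positive_solutions (h ` I) w n. ?desc (?lift g) = g"
      proof
        fix g assume "g \<in> positive_solutions (h ` I) w n"
        then have "g \<in> extensional (h ` I)" by (simp add: positive_solutions_def PiE_iff)
        then show "?desc (?lift g) = g"
          using rep by (auto simp: fun_eq_iff extensional_def)
      qed
      show "\<forall>f\<in>{f \<in> I \<rightarrow>\<^sub>E {1..}. (\<forall>i\<in>I. f (q i) = f i) \<and> (\<Sum>i\<in>I. f i) = n}. ?lift (?desc f) = f"
        using frep by (auto simp: F_def fun_eq_iff PiE_iff extensional_def)
      show "?lift ` positive_solutions (h ` I) w n \<subseteq>
        {f \<in> I \<rightarrow>\<^sub>E {1..}. (\<forall>i\<in>I. f (q i) = f i) \<and> (\<Sum>i\<in>I. f i) = n}"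
        using q by (auto simp: positive_solutions_def sum hq PiE_iff Pi_iff)
      show "?desc ` {f \<in> I \<rightarrow>\<^sub>E {1..}. (\<forall>i\<in>I. f (q i) = f i) \<and> (\<Sum>i\<in>I. f i) = n} \<subseteq>
        positive_solutions (h ` I) w n"
      proof clarify
        fix f assume f: "f \<in> I \<rightarrow>\<^sub>E {1..}" "\<forall>i\<in>I. f (q i) = f i" "n = sum f I"
        then have "f \<in> F" by (simp add: F_def)
        then have "(\<Sum>i\<in>I. ?desc f (h i)) = (\<Sum>i\<in>I. f i)"
          using frep by (intro sum.cong) auto
        then show "?desc f \<in> positive_solutions (h ` I) w (sum f I)"
          using f rep unfolding positive_solutions_def sum by (auto simp: PiE_iff)
      qed
    qed
  qed
  have "w c > 0" if "c \<in> h ` I" for c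
    using that I by (auto simp: w_def card_gt_0_iff)
  then show ?thesis
    unfolding card_eq using I by (intro eventually_quasipoly_card_positive_solutions) auto
qed

section \<open>Orbits\<close>

text \<open>The action of \<open>inv g\<close> provides preimages inside \<open>X\<close>, so each
  group element acts on \<open>X\<close> as a bijection.\<close>

lemma (in group_action) restrict_to_invariant_subset:
  assumes X: "X \<subseteq> E" and closed: "\<And>g x. g \<in> carrier G \<Longrightarrow> x \<in> X \<Longrightarrow> \<phi> g x \<in> X"
  shows "group_action G X (\<lambda>g. restrict (\<phi> g) X)"
proof -
  interpret group_hom G "BijGroup E" \<phi> by (rule group_hom)
  have Bij: "restrict (\<phi> g) X \<in> Bij X" if g: "g \<in> carrier G" for g
  proof -
    have "X \<subseteq> \<phi> g ` X"
    proof
      fix x assume x: "x \<in> X"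
      have "\<phi> g (\<phi> (inv g) x) = x"
        using orbit_sym_aux[of "inv g" x] g x X by auto
      then show "x \<in> \<phi> g ` X" using closed[of "inv g" x] g x by (metis G.inv_closed imageI)
    qed
    then have "bij_betw (restrict (\<phi> g) X) X X"
      using closed[OF g] inj_on_subset[OF inj_prop[OF g] X] by (auto simp: bij_betw_def inj_on_def)
    then show ?thesis by (simp add: Bij_def)
  qed
  moreover have "restrict (\<phi> (g \<otimes> h)) X = compose X (restrict (\<phi> g) X) (restrict (\<phi> h) X)"
    if "g \<in> carrier G" "h \<in> carrier G" for g h
    using that closed composition_rule X by (auto simp: compose_def fun_eq_iff)
  ultimately show ?thesis
    by (intro group_action.intro group_hom.intro group_hom_axioms.intro homI G.is_group group_BijGroup)
      (auto simp: BijGroup_def)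
qed

text \<open>Restriction to \<open>X\<close> changes neither the orbits of its elements nor its fixed
  points. This makes Burnside's lemma available for finite sets inside the possibly infinite
  \<open>carrier_mat m m\<close>.\<close>

lemma (in group_action) burnside_invariant_subset:
  assumes "X \<subseteq> E" "\<And>g x. g \<in> carrier G \<Longrightarrow> x \<in> X \<Longrightarrow> \<phi> g x \<in> X"
    and "finite (carrier G)" "finite X"
  shows "card (orbits G X \<phi>) * Coset.order G = (\<Sum>g\<in>carrier G. card {x \<in> X. \<phi> g x = x})"
proof -
  interpret R: group_action G X "\<lambda>g. restrict (\<phi> g) X"
    by (rule restrict_to_invariant_subset[OF assms(1,2)])
  have "orbits G X (\<lambda>g. restrict (\<phi> g) X) = orbits G X \<phi>"
    by (auto simp: orbits_def orbit_def)
  moreover have "invariants X (\<lambda>g. restrict (\<phi> g) X) g = {x \<in> X. \<phi> g x = x}" for g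
    by (auto simp: invariants_def)
  ultimately show ?thesis using R.burnside[OF assms(3,4)] by simp
qed

lemma (in group_action) orbit_eq_iff:
  assumes "x \<in> E" "y \<in> E"
  shows "orbit G \<phi> x = orbit G \<phi> y \<longleftrightarrow> y \<in> orbit G \<phi> x"
proof
  have sub: "orbit G \<phi> z \<subseteq> E" if "z \<in> E" for z
    using that element_image unfolding orbit_def by blast
  have mono: "orbit G \<phi> v \<subseteq> orbit G \<phi> u" if "u \<in> E" "v \<in> E" "v \<in> orbit G \<phi> u" for u v
    using that sub orbit_trans by blast
  show "orbit G \<phi> x = orbit G \<phi> y" if "y \<in> orbit G \<phi> x"
    using mono[of x y] mono[of y x] orbit_sym[of x y] assms that by blast
qed (use orbit_refl assms in blast)

section \<open>Orbits of matrices as relabellings of the indices\<close>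

lemma simul_perm_index:
  assumes p: "p permutes {1..n}" and A: "A \<in> carrier_mat n n" and ij: "i < n" "j < n"
  shows "simul_perm n p A $$ (p (Suc i) - 1, p (Suc j) - 1) = A $$ (i, j)"
proof -
  have "p (Suc i) \<in> {1..n}" "p (Suc j) \<in> {1..n}"
    using permutes_in_image[OF p, of "Suc i"] permutes_in_image[OF p, of "Suc j"] ij by auto
  then show ?thesis
    using A by (auto simp: simul_perm_def permutes_inverses[OF p] Suc_le_eq)
qed

lemma bij_betw_Suc_lessThan: "bij_betw Suc {..<n} {1..n}"
  by (rule bij_betw_byWitness[where f' = "\<lambda>i. i - 1"]) auto

lemma bij_betw_pred_atLeastAtMost: "bij_betw (\<lambda>i. i - 1) {1..n} {..<n::nat}"
  by (rule bij_betw_byWitness[where f' = Suc]) auto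

lemma bij_betw_shift_permutation:
  assumes "p permutes {1..n}"
  shows "bij_betw (\<lambda>i. p (Suc i) - 1) {..<n} {..<n}"
  using bij_betw_trans[OF bij_betw_trans[OF bij_betw_Suc_lessThan permutes_imp_bij[OF assms]]
      bij_betw_pred_atLeastAtMost]
  by (simp add: comp_def)

text \<open>Shifting indices by one turns permutations of \<open>{1..n}\<close> into bijections of
  \<open>{..<n}\<close>, and moving the target indices instead of the source indices removes the
  inverse from the action.\<close>

lemma mem_orbit_simul_perm_iff:
  assumes A: "A \<in> carrier_mat n n" and A': "A' \<in> carrier_mat n n"
  shows "A' \<in> orbit (sym_group n) (simul_perm n) A \<longleftrightarrow>
    (\<exists>\<sigma>. bij_betw \<sigma> {..<n} {..<n} \<and> (\<forall>i<n. \<forall>j<n. A' $$ (\<sigma> i, \<sigma> j) = A $$ (i, j)))"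
proof
  assume "A' \<in> orbit (sym_group n) (simul_perm n) A"
  then obtain p where p: "p permutes {1..n}" and "A' = simul_perm n p A"
    unfolding orbit_def by (auto simp: sym_group_carrier)
  then show "\<exists>\<sigma>. bij_betw \<sigma> {..<n} {..<n} \<and> (\<forall>i<n. \<forall>j<n. A' $$ (\<sigma> i, \<sigma> j) = A $$ (i, j))"
    using bij_betw_shift_permutation[OF p] simul_perm_index[OF p A] by blast
next
  assume "\<exists>\<sigma>. bij_betw \<sigma> {..<n} {..<n} \<and> (\<forall>i<n. \<forall>j<n. A' $$ (\<sigma> i, \<sigma> j) = A $$ (i, j))"
  then obtain \<sigma> where \<sigma>: "bij_betw \<sigma> {..<n} {..<n}"
    and eq: "\<And>i j. i < n \<Longrightarrow> j < n \<Longrightarrow> A' $$ (\<sigma> i, \<sigma> j) = A $$ (i, j)"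
    by blast
  \<comment> \<open>\<open>\<sigma>\<close> conjugated with the index shift, and the identity
    outside \<open>{1..n}\<close> as \<open>permutes\<close> demands.\<close>
  define p where "p x = (if x \<in> {1..n} then Suc (\<sigma> (x - 1)) else x)" for x
  have "bij_betw (\<lambda>x. Suc (\<sigma> (x - 1))) {1..n} {1..n}"
    using bij_betw_trans[OF bij_betw_trans[OF bij_betw_pred_atLeastAtMost \<sigma>] bij_betw_Suc_lessThan]
    by (simp add: comp_def)
  then have "bij_betw p {1..n} {1..n}"
    by (rule bij_betw_cong[THEN iffD1, rotated]) (simp add: p_def)
  then have p: "p permutes {1..n}"
    by (rule bij_imp_permutes) (auto simp: p_def)
  have "simul_perm n p A = A'"
  proof (rule eq_matI)
    fix i j assume "i < dim_row A'" "j < dim_col A'"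
    then have "i \<in> \<sigma> ` {..<n}" "j \<in> \<sigma> ` {..<n}"
      using A' \<sigma> by (auto simp: bij_betw_def)
    then obtain a b where ab: "a < n" "b < n" "i = \<sigma> a" "j = \<sigma> b" by auto
    then show "simul_perm n p A $$ (i, j) = A' $$ (i, j)"
      using simul_perm_index[OF p A ab(1,2)] eq[OF ab(1,2)] by (simp add: p_def)
  qed (use A A' in \<open>auto simp: simul_perm_def\<close>)
  then show "A' \<in> orbit (sym_group n) (simul_perm n) A"
    using p unfolding orbit_def by (auto simp: sym_group_carrier)
qed

lemma orbit_simul_perm_eq_iff:
  assumes "A \<in> carrier_mat n n" "A' \<in> carrier_mat n n"
  shows "orbit (sym_group n) (simul_perm n) A = orbit (sym_group n) (simul_perm n) A' \<longleftrightarrow>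
    (\<exists>\<sigma>. bij_betw \<sigma> {..<n} {..<n} \<and> (\<forall>i<n. \<forall>j<n. A' $$ (\<sigma> i, \<sigma> j) = A $$ (i, j)))"
  using group_action.orbit_eq_iff[OF simul_perm_group_action assms] mem_orbit_simul_perm_iff[OF assms]
  by simp

section \<open>Twin-free reduction\<close>

definition twin_free :: "nat \<Rightarrow> 'a mat \<Rightarrow> bool" where
  "twin_free m B \<longleftrightarrow> (\<forall>a<m. \<forall>b<m.
     (\<forall>l<m. B $$ (a, l) = B $$ (b, l) \<and> B $$ (l, a) = B $$ (l, b)) \<longrightarrow> a = b)"

text \<open>\<open>s\<close> sends an index to the label of its class. This is a relation and not a
  function because the labelling of the classes is arbitrary.\<close>

definition blowup :: "nat \<Rightarrow> 'a mat \<Rightarrow> nat \<Rightarrow> 'a mat \<Rightarrow> (nat \<Rightarrow> nat) \<Rightarrow> (nat \<Rightarrow> nat) \<Rightarrow> bool" where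
  "blowup n A m B f s \<longleftrightarrow> s ` {..<n} = {..<m} \<and>
     (\<forall>i<n. \<forall>j<n. A $$ (i, j) = B $$ (s i, s j)) \<and> (\<forall>b<m. card {i. i < n \<and> s i = b} = f b)"

lemma blowup_less: "blowup n A m B f s \<Longrightarrow> i < n \<Longrightarrow> s i < m"
  unfolding blowup_def by blast

text \<open>Since \<open>s\<close> is onto, twins of \<open>A\<close> go to twins of
  \<open>B\<close>, which coincide. The fibres of \<open>s\<close> are thus the twin classes of
  \<open>A\<close>, whatever \<open>s\<close> is.\<close>

lemma blowup_kernel:
  assumes "blowup n A m B f s" "twin_free m B" "i < n" "j < n"
  shows "s i = s j \<longleftrightarrow> (\<forall>l<n. A $$ (i, l) = A $$ (j, l) \<and> A $$ (l, i) = A $$ (l, j))"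
proof
  assume *: "\<forall>l<n. A $$ (i, l) = A $$ (j, l) \<and> A $$ (l, i) = A $$ (l, j)"
  have "B $$ (s i, l) = B $$ (s j, l) \<and> B $$ (l, s i) = B $$ (l, s j)" if "l < m" for l
  proof -
    have "l \<in> s ` {..<n}" using assms(1) that by (simp add: blowup_def)
    then obtain l' where "l' < n" "l = s l'" by auto
    moreover have "B $$ (s a, s b) = A $$ (a, b)" if "a < n" "b < n" for a b
      using assms(1) that by (simp add: blowup_def)
    ultimately show ?thesis using * assms(3,4) by simp
  qed
  then show "s i = s j"
    using assms(2) blowup_less[OF assms(1) assms(3)] blowup_less[OF assms(1) assms(4)]
    by (simp add: twin_free_def)
qed (use assms in \<open>simp add: blowup_def\<close>)

text \<open>A relabelling of \<open>A\<close> respects twin classes and so induces a relabelling of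
  the reduced matrix. Conversely, a relabelling of the reduced matrix that respects class sizes
  lifts, because classes of equal size can be matched.\<close>

lemma blowup_orbit_iff:
  assumes R: "blowup n A m B f s" "twin_free m B"
    and R': "blowup n A' m' B' f' s'" "twin_free m' B'"
  shows "(\<exists>\<sigma>. bij_betw \<sigma> {..<n} {..<n} \<and> (\<forall>i<n. \<forall>j<n. A' $$ (\<sigma> i, \<sigma> j) = A $$ (i, j))) \<longleftrightarrow>
    m = m' \<and> (\<exists>\<pi>. bij_betw \<pi> {..<m} {..<m} \<and>
      (\<forall>a<m. \<forall>b<m. B' $$ (\<pi> a, \<pi> b) = B $$ (a, b)) \<and> (\<forall>a<m. f' (\<pi> a) = f a))"
proof (intro iffI; elim exE conjE)
  fix \<sigma> assume \<sigma>: "bij_betw \<sigma> {..<n} {..<n}"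
    and eq: "\<forall>i<n. \<forall>j<n. A' $$ (\<sigma> i, \<sigma> j) = A $$ (i, j)"
  have \<sigma>lt: "\<sigma> i < n" if "i < n" for i using \<sigma> that by (auto simp: bij_betw_def)
  have \<sigma>surj: "\<exists>i<n. j = \<sigma> i" if "j < n" for j
    using \<sigma> that unfolding bij_betw_def by (metis imageE lessThan_iff)
  define t where "t i = s' (\<sigma> i)" for i
  \<comment> \<open>\<open>s\<close> and \<open>t\<close> have the same fibres, the twin classes of
    \<open>A\<close>; hence \<open>\<pi>\<close> below does not depend on the chosen
    preimage.\<close>
  have kernel: "s i = s j \<longleftrightarrow> t i = t j" if ij: "i < n" "j < n" for i j
  proof -
    have "t i = t j \<longleftrightarrow>
      (\<forall>l<n. A' $$ (\<sigma> i, l) = A' $$ (\<sigma> j, l) \<and> A' $$ (l, \<sigma> i) = A' $$ (l, \<sigma> j))"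
      unfolding t_def by (rule blowup_kernel[OF R' \<sigma>lt[OF ij(1)] \<sigma>lt[OF ij(2)]])
    also have "\<dots> \<longleftrightarrow> (\<forall>l<n. A' $$ (\<sigma> i, \<sigma> l) = A' $$ (\<sigma> j, \<sigma> l) \<and> A' $$ (\<sigma> l, \<sigma> i) = A' $$ (\<sigma> l, \<sigma> j))"
      using \<sigma>lt \<sigma>surj by metis
    also have "\<dots> \<longleftrightarrow> s i = s j"
      using eq ij by (simp add: blowup_kernel[OF R ij])
    finally show ?thesis by simp
  qed
  have s: "s ` {..<n} = {..<m}" and s': "s' ` {..<n} = {..<m'}"
    using R R' by (auto simp: blowup_def)
  have t: "t ` {..<n} = {..<m'}"
    unfolding s'[symmetric] t_def using \<sigma> by (metis bij_betw_def image_image)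
  define \<pi> where "\<pi> b = t (inv_into {..<n} s b)" for b
  have \<pi>s: "\<pi> (s i) = t i" if "i < n" for i
  proof -
    have "s i \<in> s ` {..<n}" using that by auto
    from inv_into_into[OF this] f_inv_into_f[OF this] show ?thesis
      unfolding \<pi>_def using kernel[of "inv_into {..<n} s (s i)" i] that by simp
  qed
  have lift: "\<exists>i<n. b = s i" if "b < m" for b
    using s that by (metis imageE lessThan_iff)
  have "inj_on \<pi> {..<m}"
  proof (rule inj_onI)
    fix a b assume "a \<in> {..<m}" "b \<in> {..<m}" "\<pi> a = \<pi> b"
    then show "a = b" using lift[of a] lift[of b] \<pi>s kernel by (metis lessThan_iff)
  qed
  moreover have "\<pi> ` {..<m} = {..<m'}"
    unfolding s[symmetric] t[symmetric] image_image using \<pi>s by (intro image_cong) auto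
  ultimately have bij: "bij_betw \<pi> {..<m} {..<m'}" by (simp add: bij_betw_def)
  then have mm': "m = m'" using bij_betw_same_card by fastforce
  have "B' $$ (\<pi> a, \<pi> b) = B $$ (a, b)" if ab: "a < m" "b < m" for a b
  proof -
    obtain i j where ij: "i < n" "j < n" "a = s i" "b = s j" using lift ab by blast
    have "B' $$ (\<pi> a, \<pi> b) = A' $$ (\<sigma> i, \<sigma> j)"
      using R'(1) ij \<sigma>lt by (simp add: \<pi>s t_def blowup_def)
    also have "\<dots> = B $$ (a, b)"
      using eq R(1) ij by (simp add: blowup_def)
    finally show ?thesis .
  qed
  moreover have "f' (\<pi> a) = f a" if a: "a < m" for a
  proof -
    have "\<pi> a < m'" using bij a by (auto simp: bij_betw_def)
    then have "f' (\<pi> a) = card {i. i < n \<and> s' i = \<pi> a}"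
      using R'(1) by (simp add: blowup_def)
    also have "\<dots> = card (\<sigma> ` {i. i < n \<and> s i = a})"
    proof -
      obtain i0 where i0: "i0 < n" "a = s i0" using lift a by blast
      have "{i. i < n \<and> s' i = \<pi> a} = \<sigma> ` {i. i < n \<and> s i = a}"
      proof (intro equalityI subsetI)
        fix j assume j: "j \<in> {i. i < n \<and> s' i = \<pi> a}"
        then obtain i where i: "i < n" "j = \<sigma> i" using \<sigma>surj by blast
        then have "t i = t i0" using j i0 \<pi>s[of i0] by (simp add: t_def)
        then have "s i = a" using kernel i i0 by simp
        then show "j \<in> \<sigma> ` {i. i < n \<and> s i = a}" using i by blast
      next
        fix j assume "j \<in> \<sigma> ` {i. i < n \<and> s i = a}"
        then obtain i where i: "i < n" "s i = a" "j = \<sigma> i" by blast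
        then show "j \<in> {i. i < n \<and> s' i = \<pi> a}"
          using \<pi>s[of i] \<sigma>lt by (simp add: t_def)
      qed
      then show ?thesis by simp
    qed
    also have "\<dots> = card {i. i < n \<and> s i = a}"
      using \<sigma> by (intro card_image inj_on_subset[OF bij_betw_imp_inj_on[OF \<sigma>]]) auto
    also have "\<dots> = f a"
      using R(1) a by (simp add: blowup_def)
    finally show ?thesis .
  qed
  ultimately show "m = m' \<and> (\<exists>\<pi>. bij_betw \<pi> {..<m} {..<m} \<and>
      (\<forall>a<m. \<forall>b<m. B' $$ (\<pi> a, \<pi> b) = B $$ (a, b)) \<and> (\<forall>a<m. f' (\<pi> a) = f a))"
    using bij mm' by blast
next
  fix \<pi> assume mm': "m = m'" and \<pi>: "bij_betw \<pi> {..<m} {..<m}"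
    and B: "\<forall>a<m. \<forall>b<m. B' $$ (\<pi> a, \<pi> b) = B $$ (a, b)" and f: "\<forall>a<m. f' (\<pi> a) = f a"
  have slt: "s i < m" if "i < n" for i using blowup_less[OF R(1) that] .
  have s'lt: "s' i < m" if "i < n" for i using blowup_less[OF R'(1) that] mm' by simp
  \<comment> \<open>Equal fibre sizes mean that \<open>\<pi> \<circ> s\<close> and \<open>s'\<close>
    have the same multiset of values; a permutation of the indices then turns one map into the
    other.\<close>
  have "card {i \<in> {..<n}. \<pi> (s i) = c} = card {i \<in> {..<n}. s' i = c}" for c
  proof (cases "c < m")
    case True
    then obtain a where a: "a < m" "c = \<pi> a"
      using \<pi> unfolding bij_betw_def by (metis imageE lessThan_iff)
    have "{i \<in> {..<n}. \<pi> (s i) = c} = {i. i < n \<and> s i = a}"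
      using slt \<pi> a by (auto simp: bij_betw_def inj_on_def)
    then have "card {i \<in> {..<n}. \<pi> (s i) = c} = f a"
      using R(1) a by (simp add: blowup_def)
    also have "\<dots> = f' c" using f a by simp
    also have "\<dots> = card {i \<in> {..<n}. s' i = c}"
      using R'(1) True mm' by (simp add: blowup_def)
    finally show ?thesis .
  next
    case False
    moreover have "\<pi> (s i) < m" if "i < n" for i
      using \<pi> slt[OF that] by (auto simp: bij_betw_def)
    ultimately have "{i \<in> {..<n}. \<pi> (s i) = c} = {}" "{i \<in> {..<n}. s' i = c} = {}"
      using s'lt by auto
    then show ?thesis by (simp only:)
  qed
  then have "image_mset (\<lambda>i. \<pi> (s i)) (mset_set {..<n}) = image_mset s' (mset_set {..<n})"
    by (intro multiset_eqI) (simp add: count_image_mset_eq_card_vimage)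
  then obtain \<sigma> where \<sigma>: "\<sigma> permutes {..<n}" "\<forall>i\<in>{..<n}. \<pi> (s i) = s' (\<sigma> i)"
    using image_mset_eq_implies_permutes[OF finite_lessThan] by blast
  have "A' $$ (\<sigma> i, \<sigma> j) = A $$ (i, j)" if ij: "i < n" "j < n" for i j
  proof -
    have "\<sigma> i < n" "\<sigma> j < n"
      using permutes_in_image[OF \<sigma>(1)] ij by auto
    then have "A' $$ (\<sigma> i, \<sigma> j) = B' $$ (\<pi> (s i), \<pi> (s j))"
      using R'(1) \<sigma>(2) ij by (simp add: blowup_def)
    also have "\<dots> = A $$ (i, j)"
      using B slt ij R(1) by (simp add: blowup_def)
    finally show ?thesis .
  qed
  then show "\<exists>\<sigma>. bij_betw \<sigma> {..<n} {..<n} \<and> (\<forall>i<n. \<forall>j<n. A' $$ (\<sigma> i, \<sigma> j) = A $$ (i, j))"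
    using permutes_imp_bij[OF \<sigma>(1)] by blast
qed

section \<open>Existence of reductions and of blow-ups\<close>

lemma exists_map_with_fibre_sizes:
  fixes f :: "nat \<Rightarrow> nat"
  assumes "(\<Sum>b<m. f b) = n"
  obtains s where "s ` {..<n} \<subseteq> {..<m}" "\<And>b. b < m \<Longrightarrow> card {i. i < n \<and> s i = b} = f b"
proof -
  \<comment> \<open>Disjoint blocks of sizes \<open>f b\<close> have \<open>n\<close> elements in
    total; an index is sent to the block in which the enumeration \<open>h\<close> puts it.\<close>
  have "card (SIGMA b:{..<m}. {..<f b}) = n" using assms by simp
  then obtain h where h: "bij_betw h {..<n} (SIGMA b:{..<m}. {..<f b})"
    by (metis bij_betw_iff_card card_lessThan finite_SigmaI finite_lessThan)
  then have h_in: "h i \<in> (SIGMA b:{..<m}. {..<f b})" if "i < n" for i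
    using that by (auto simp: bij_betw_def)
  show thesis
  proof
    show "(\<lambda>i. fst (h i)) ` {..<n} \<subseteq> {..<m}"
      using h_in by (fastforce simp: mem_Sigma_iff)
    fix b assume "b < m"
    have "h ` {i. i < n \<and> fst (h i) = b} = {b} \<times> {..<f b}"
    proof (intro equalityI subsetI)
      fix y assume "y \<in> {b} \<times> {..<f b}"
      then have "y \<in> h ` {..<n}" "fst y = b"
        using h \<open>b < m\<close> by (auto simp: bij_betw_def)
      then show "y \<in> h ` {i. i < n \<and> fst (h i) = b}" by auto
    next
      fix y assume "y \<in> h ` {i. i < n \<and> fst (h i) = b}"
      then obtain i where "i < n" "fst (h i) = b" "y = h i" by auto
      then show "y \<in> {b} \<times> {..<f b}" using h_in[of i] by (cases y) auto
    qed
    moreover have "card (h ` {i. i < n \<and> fst (h i) = b}) = card {i. i < n \<and> fst (h i) = b}"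
      using h by (intro card_image inj_on_subset[OF bij_betw_imp_inj_on[OF h]]) auto
    ultimately show "card {i. i < n \<and> fst (h i) = b} = f b" by simp
  qed
qed

definition compositions :: "nat \<Rightarrow> nat \<Rightarrow> (nat \<Rightarrow> nat) set" where
  "compositions m n = {f \<in> {..<m} \<rightarrow>\<^sub>E {1..}. (\<Sum>b<m. f b) = n}"

definition twin_free_rank_matrices :: "'a::field set \<Rightarrow> nat \<Rightarrow> nat \<Rightarrow> 'a mat set" where
  "twin_free_rank_matrices S k m = {B \<in> rank_matrices S k m. twin_free m B}"

lemma finite_rank_matrices:
  assumes "finite S"
  shows "finite (rank_matrices S k n)"
proof (rule finite_subset)
  show "rank_matrices S k n \<subseteq> (\<lambda>g. mat n n g) ` (({..<n} \<times> {..<n}) \<rightarrow>\<^sub>E S)"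
  proof
    fix A assume A: "A \<in> rank_matrices S k n"
    then have "A = mat n n (restrict (\<lambda>ij. A $$ ij) ({..<n} \<times> {..<n}))"
      by (intro eq_matI) (auto simp: rank_matrices_def)
    moreover have "restrict (\<lambda>ij. A $$ ij) ({..<n} \<times> {..<n}) \<in> ({..<n} \<times> {..<n}) \<rightarrow>\<^sub>E S"
      using A by (auto simp: rank_matrices_def)
    ultimately show "A \<in> (\<lambda>g. mat n n g) ` (({..<n} \<times> {..<n}) \<rightarrow>\<^sub>E S)" by blast
  qed
qed (use assms in \<open>simp add: finite_PiE\<close>)

text \<open>Indices with equal rows and equal columns are merged, and \<open>B\<close> keeps one
  representative of each class. There are at most as many classes as pairs of a row and a column of
  \<open>A\<close>, which gives a bound free of \<open>n\<close>.\<close>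

lemma exists_twin_free_reduction:
  fixes S :: "'a::field set"
  assumes A: "A \<in> rank_matrices S k n" and finS: "finite S"
  obtains m B f s where "m \<le> card S ^ k * Suc (card S) ^ (card S ^ k)"
    "B \<in> twin_free_rank_matrices S k m" "f \<in> compositions m n" "blowup n A m B f s"
proof -
  have carA: "A \<in> carrier_mat n n" and SA: "\<And>i j. i < n \<Longrightarrow> j < n \<Longrightarrow> A $$ (i, j) \<in> S"
    and rankA: "vec_space.rank n A = k"
    using A by (auto simp: rank_matrices_def)
  define tw where "tw i = (row A i, col A i)" for i
  define m where "m = card (tw ` {..<n})"
  obtain h where h: "bij_betw h (tw ` {..<n}) {..<m}"
    unfolding m_def using ex_bij_betw_finite_nat[of "tw ` {..<n}"] by (auto simp: atLeast0LessThan)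
  define s where "s i = h (tw i)" for i
  define rep where "rep b = inv_into {..<n} s b" for b
  define B where "B = mat m m (\<lambda>(a, b). A $$ (rep a, rep b))"
  define f where "f = (\<lambda>b\<in>{..<m}. card {i. i < n \<and> s i = b})"
  have s: "s ` {..<n} = {..<m}"
    using h by (simp add: s_def bij_betw_def image_image[symmetric])
  have rep: "rep b < n" "s (rep b) = b" if "b < m" for b
    using inv_into_into[of b s "{..<n}"] f_inv_into_f[of b s "{..<n}"] that s by (auto simp: rep_def)
  have s_tw: "tw i = tw j" if "i < n" "j < n" "s i = s j" for i j
    using that inj_onD[OF bij_betw_imp_inj_on[OF h], of "tw i" "tw j"] by (simp add: s_def)
  have slt: "s i < m" if "i < n" for i using s that by auto
  \<comment> \<open>The row index is replaced by its representative first, using equal rows, then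
    the column index, using equal columns.\<close>
  have AB: "A $$ (i, j) = B $$ (s i, s j)" if ij: "i < n" "j < n" for i j
  proof -
    have r: "rep (s i) < n" "tw (rep (s i)) = tw i" "rep (s j) < n" "tw (rep (s j)) = tw j"
      using rep[OF slt[OF ij(1)]] rep[OF slt[OF ij(2)]] s_tw[of "rep (s i)" i] s_tw[of "rep (s j)" j] ij
      by simp_all
    have "A $$ (i, j) = row A i $ j" using carA ij by simp
    also have "\<dots> = row A (rep (s i)) $ j" using r(2) by (simp add: tw_def)
    also have "\<dots> = col A j $ rep (s i)" using carA ij r(1) by simp
    also have "\<dots> = col A (rep (s j)) $ rep (s i)" using r(4) by (simp add: tw_def)
    also have "\<dots> = B $$ (s i, s j)" using carA r slt ij by (simp add: B_def)
    finally show ?thesis .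
  qed
  have carB: "B \<in> carrier_mat m m" by (simp add: B_def)
  have "twin_free m B"
    unfolding twin_free_def
  proof (intro allI impI)
    fix a b assume a: "a < m" and b: "b < m"
      and twins: "\<forall>l<m. B $$ (a, l) = B $$ (b, l) \<and> B $$ (l, a) = B $$ (l, b)"
    \<comment> \<open>Every index of \<open>A\<close> takes its entries from its class, so twins of
      \<open>B\<close> have representatives that are twins in all of \<open>A\<close>.\<close>
    have "A $$ (rep a, l) = A $$ (rep b, l)" "A $$ (l, rep a) = A $$ (l, rep b)" if "l < n" for l
      using twins slt[OF that] AB that rep a b by simp_all
    then have "tw (rep a) = tw (rep b)"
      using carA rep a b by (auto simp: tw_def intro!: eq_vecI)
    then have "s (rep a) = s (rep b)" by (simp add: s_def)
    then show "a = b" using rep a b by simp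
  qed
  moreover have "vec_space.rank m B = k"
    using rank_blowup[OF carA carB s s AB] rankA by simp
  ultimately have B: "B \<in> twin_free_rank_matrices S k m"
    using carB rep SA by (simp add: twin_free_rank_matrices_def rank_matrices_def B_def)
  have R: "blowup n A m B f s"
    using s AB by (simp add: blowup_def f_def)
  have "f \<in> compositions m n"
  proof -
    have "f b \<ge> 1" if "b < m" for b
    proof -
      have "rep b \<in> {i. i < n \<and> s i = b}" using rep that by simp
      then have "card {i. i < n \<and> s i = b} > 0" by (subst card_gt_0_iff) auto
      then show ?thesis using that by (simp add: f_def)
    qed
    moreover have "(\<Sum>b<m. f b) = n"
    proof -
      have "n = (\<Sum>i<n. 1)" by simp
      also have "\<dots> = (\<Sum>b<m. card {i \<in> {..<n}. s i = b})"
        using sum_fun_comp[of "{..<n}" "{..<m}" s "\<lambda>_. 1::nat"] s by simp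
      also have "\<dots> = (\<Sum>b<m. f b)" by (intro sum.cong) (simp_all add: f_def)
      finally show ?thesis by simp
    qed
    ultimately show ?thesis by (auto simp: compositions_def f_def)
  qed
  moreover have "m \<le> card S ^ k * Suc (card S) ^ (card S ^ k)"
  proof -
    have rows: "card (row A ` {..<n}) \<le> card S ^ k"
      using card_rows_le_power_rank[OF carA finS SA] rankA by simp
    have "card (col A ` {..<n}) \<le> card S ^ card (row A ` {..<n})"
      by (rule card_cols_le_power_rows[OF carA finS SA])
    \<comment> \<open>\<open>Suc\<close> keeps the base at least 1, which makes the power monotone
      in the exponent even for empty \<open>S\<close>.\<close>
    also have "\<dots> \<le> Suc (card S) ^ card (row A ` {..<n})"
      by (intro power_mono) auto
    also have "\<dots> \<le> Suc (card S) ^ (card S ^ k)"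
      using rows by (intro power_increasing) auto
    finally have cols: "card (col A ` {..<n}) \<le> Suc (card S) ^ (card S ^ k)" .
    have "m \<le> card (row A ` {..<n} \<times> col A ` {..<n})"
      unfolding m_def by (intro card_mono) (auto simp: tw_def)
    also have "\<dots> \<le> card S ^ k * Suc (card S) ^ (card S ^ k)"
      unfolding card_cartesian_product by (intro mult_mono rows cols) auto
    finally show ?thesis .
  qed
  ultimately show thesis using B R that by blast
qed

text \<open>Positive parts make all fibres of \<open>s\<close> nonempty, so \<open>s\<close> is onto
  and \<open>rank_blowup\<close> applies. This is the converse of the reduction.\<close>

lemma exists_blowup:
  fixes S :: "'a::field set"
  assumes B: "B \<in> rank_matrices S k m" and f: "f \<in> compositions m n"
  obtains A s where "A \<in> rank_matrices S k n" "blowup n A m B f s"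
proof -
  have carB: "B \<in> carrier_mat m m" and SB: "\<And>i j. i < m \<Longrightarrow> j < m \<Longrightarrow> B $$ (i, j) \<in> S"
    and rankB: "vec_space.rank m B = k"
    using B by (auto simp: rank_matrices_def)
  obtain s where s: "s ` {..<n} \<subseteq> {..<m}" "\<And>b. b < m \<Longrightarrow> card {i. i < n \<and> s i = b} = f b"
    using exists_map_with_fibre_sizes[of f m n] f by (auto simp: compositions_def)
  have "b \<in> s ` {..<n}" if "b < m" for b
  proof -
    have "f b \<in> {1..}" using f that by (auto simp: compositions_def)
    then have "card {i. i < n \<and> s i = b} > 0" using s(2)[OF that] by simp
    then show ?thesis unfolding card_gt_0_iff by auto
  qed
  with s(1) have surj: "s ` {..<n} = {..<m}" by auto
  define A where "A = mat n n (\<lambda>(i, j). B $$ (s i, s j))"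
  have carA: "A \<in> carrier_mat n n" by (simp add: A_def)
  have AB: "A $$ (i, j) = B $$ (s i, s j)" if "i < n" "j < n" for i j
    using that by (simp add: A_def)
  have "A $$ (i, j) \<in> S" if "i < n" "j < n" for i j
    using AB[OF that] SB s(1) that by auto
  then have "A \<in> rank_matrices S k n"
    using carA rank_blowup[OF carA carB surj surj AB] rankB by (simp add: rank_matrices_def)
  moreover have "blowup n A m B f s"
    using surj AB s(2) by (simp add: blowup_def)
  ultimately show thesis by (rule that)
qed

section \<open>Weighted twin-free matrices and the final count\<close>

text \<open>Packing a reduced matrix and its fibre sizes into a single matrix makes the simultaneous
  permutation action available for such pairs.\<close>
definition weighted :: "nat \<Rightarrow> 'a mat \<Rightarrow> (nat \<Rightarrow> nat) \<Rightarrow> ('a \<times> nat) mat" where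
  "weighted m B f = mat m m (\<lambda>(a, b). (B $$ (a, b), f a))"

lemma weighted_carrier [simp]: "weighted m B f \<in> carrier_mat m m"
  by (simp add: weighted_def)

lemma weighted_index [simp]: "a < m \<Longrightarrow> b < m \<Longrightarrow> weighted m B f $$ (a, b) = (B $$ (a, b), f a)"
  by (simp add: weighted_def)

lemma inj_on_weighted:
  "inj_on (\<lambda>(B, f). weighted m B f) (carrier_mat m m \<times> extensional {..<m})"
proof (rule inj_onI, clarify)
  fix B B' :: "'a mat" and f f'
  assume B: "B \<in> carrier_mat m m" "B' \<in> carrier_mat m m"
    and f: "f \<in> extensional {..<m}" "f' \<in> extensional {..<m}"
    and eq: "weighted m B f = weighted m B' f'"
  have eq': "B $$ (a, b) = B' $$ (a, b) \<and> f a = f' a" if "a < m" "b < m" for a b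
    using arg_cong[OF eq, of "\<lambda>C. C $$ (a, b)"] that by simp
  have "B = B'"
    using B eq' by (intro eq_matI) auto
  moreover have "f = f'"
    using f eq' by (intro extensionalityI[of f "{..<m}" f']) auto
  ultimately show "B = B' \<and> f = f'" by simp
qed

text \<open>The right-hand side is the condition on \<open>\<pi>\<close> in
  \<open>blowup_orbit_iff\<close>, which links these orbits to those of the large matrices.\<close>

lemma orbit_weighted_eq_iff:
  "orbit (sym_group m) (simul_perm m) (weighted m B f) = orbit (sym_group m) (simul_perm m) (weighted m B' f')
   \<longleftrightarrow> (\<exists>\<pi>. bij_betw \<pi> {..<m} {..<m} \<and>
      (\<forall>a<m. \<forall>b<m. B' $$ (\<pi> a, \<pi> b) = B $$ (a, b)) \<and> (\<forall>a<m. f' (\<pi> a) = f a))"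
proof -
  have "(\<forall>a<m. \<forall>b<m. weighted m B' f' $$ (\<pi> a, \<pi> b) = weighted m B f $$ (a, b)) \<longleftrightarrow>
      (\<forall>a<m. \<forall>b<m. B' $$ (\<pi> a, \<pi> b) = B $$ (a, b)) \<and> (\<forall>a<m. f' (\<pi> a) = f a)"
    if "bij_betw \<pi> {..<m} {..<m}" for \<pi>
  proof -
    have "\<pi> a < m" if "a < m" for a
      using that \<open>bij_betw \<pi> {..<m} {..<m}\<close> by (auto simp: bij_betw_def)
    then show ?thesis by auto
  qed
  then show ?thesis
    unfolding orbit_simul_perm_eq_iff[OF weighted_carrier weighted_carrier] by blast
qed

definition weighted_matrices :: "'a::field set \<Rightarrow> nat \<Rightarrow> nat \<Rightarrow> nat \<Rightarrow> ('a \<times> nat) mat set" where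
  "weighted_matrices S k m n =
     (\<lambda>(B, f). weighted m B f) ` (twin_free_rank_matrices S k m \<times> compositions m n)"

text \<open>A bijective relabelling is a special blow-up, so \<open>rank_blowup\<close> gives the
  rank; twin-freeness is carried along the bijection.\<close>

lemma simul_perm_twin_free_rank_matrices:
  assumes p: "p permutes {1..m}" and B: "B \<in> twin_free_rank_matrices S k m"
  shows "simul_perm m p B \<in> twin_free_rank_matrices S k m"
proof -
  let ?B = "simul_perm m p B"
  define q where "q i = p (Suc i) - 1" for i
  have q: "bij_betw q {..<m} {..<m}"
    unfolding q_def by (rule bij_betw_shift_permutation[OF p])
  have carB: "B \<in> carrier_mat m m" and tf: "twin_free m B"
    using B by (auto simp: twin_free_rank_matrices_def rank_matrices_def)
  then have car: "?B \<in> carrier_mat m m" by (simp add: simul_perm_def)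
  have eq: "?B $$ (q i, q j) = B $$ (i, j)" if "i < m" "j < m" for i j
    using simul_perm_index[OF p carB that] by (simp add: q_def)
  have surj: "q ` {..<m} = {..<m}" using q by (simp add: bij_betw_def)
  then have lift: "\<exists>a<m. i = q a" if "i < m" for i
    using that by (metis imageE lessThan_iff)
  have qlt: "q a < m" if "a < m" for a using surj that by auto
  have "vec_space.rank m B = vec_space.rank m ?B"
    using rank_blowup[OF carB car surj surj] eq by simp
  moreover have "?B $$ (i, j) \<in> S" if "i < m" "j < m" for i j
  proof -
    obtain a b where "a < m" "b < m" "i = q a" "j = q b" using lift[OF \<open>i < m\<close>] lift[OF \<open>j < m\<close>] by blast
    then show ?thesis
      using eq B by (simp add: twin_free_rank_matrices_def rank_matrices_def)
  qed
  moreover have "twin_free m ?B"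
    unfolding twin_free_def
  proof (intro allI impI)
    fix i j assume ij: "i < m" "j < m"
      and twins: "\<forall>l<m. ?B $$ (i, l) = ?B $$ (j, l) \<and> ?B $$ (l, i) = ?B $$ (l, j)"
    obtain a b where ab: "a < m" "b < m" "i = q a" "j = q b" using lift[OF ij(1)] lift[OF ij(2)] by blast
    have "B $$ (a, l) = B $$ (b, l) \<and> B $$ (l, a) = B $$ (l, b)" if "l < m" for l
      using twins[rule_format, OF qlt[OF that]] ab that by (simp add: eq)
    then show "i = j" using tf ab unfolding twin_free_def by blast
  qed
  ultimately show ?thesis
    using car B by (simp add: twin_free_rank_matrices_def rank_matrices_def)
qed

lemma simul_perm_weighted_matrices:
  assumes p: "p permutes {1..m}" and C: "C \<in> weighted_matrices S k m n"
  shows "simul_perm m p C \<in> weighted_matrices S k m n"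
proof -
  obtain B f where B: "B \<in> twin_free_rank_matrices S k m" and f: "f \<in> compositions m n"
    and C_eq: "C = weighted m B f"
    using C by (auto simp: weighted_matrices_def)
  define r where "r i = inv' p (Suc i) - 1" for i
  have r: "bij_betw r {..<m} {..<m}"
    unfolding r_def by (rule bij_betw_shift_permutation[OF permutes_inv[OF p]])
  have rlt: "r a < m" if "a < m" for a using r that by (auto simp: bij_betw_def)
  have carB: "B \<in> carrier_mat m m"
    using B by (auto simp: twin_free_rank_matrices_def rank_matrices_def)
  \<comment> \<open>The action reads entries at indices moved by the inverse permutation
    \<open>r\<close>, so the parts are moved in the same way.\<close>
  define g where "g = (\<lambda>a\<in>{..<m}. f (r a))"
  have "(\<Sum>a<m. g a) = (\<Sum>a<m. f (r a))" by (simp add: g_def)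
  also have "\<dots> = (\<Sum>a<m. f a)" by (rule sum.reindex_bij_betw[OF r])
  finally have "g \<in> compositions m n"
    using f rlt by (auto simp: compositions_def g_def PiE_iff)
  moreover have "simul_perm m p C = weighted m (simul_perm m p B) g"
    unfolding C_eq using carB rlt
    by (intro eq_matI) (auto simp: simul_perm_def weighted_def g_def r_def[symmetric] simp del: One_nat_def)
  ultimately show ?thesis
    using simul_perm_twin_free_rank_matrices[OF p B] unfolding weighted_matrices_def
    by (intro image_eqI[where x = "(simul_perm m p B, g)"]) auto
qed

lemma finite_twin_free_rank_matrices: "finite S \<Longrightarrow> finite (twin_free_rank_matrices S k m)"
  by (rule finite_subset[OF _ finite_rank_matrices]) (auto simp: twin_free_rank_matrices_def)

lemma finite_compositions: "finite (compositions m n)"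
  using finite_positive_solutions[of "{..<m}" "\<lambda>_. 1" n]
  by (simp add: compositions_def positive_solutions_def)

lemma simul_perm_fixed_iff:
  assumes p: "p permutes {1..m}" and C: "C \<in> carrier_mat m m"
  shows "simul_perm m p C = C \<longleftrightarrow>
    (\<forall>a<m. \<forall>b<m. C $$ (p (Suc a) - 1, p (Suc b) - 1) = C $$ (a, b))"
proof
  assume "simul_perm m p C = C"
  then show "\<forall>a<m. \<forall>b<m. C $$ (p (Suc a) - 1, p (Suc b) - 1) = C $$ (a, b)"
    using simul_perm_index[OF p C] by simp
next
  assume *: "\<forall>a<m. \<forall>b<m. C $$ (p (Suc a) - 1, p (Suc b) - 1) = C $$ (a, b)"
  show "simul_perm m p C = C"
  proof (rule eq_matI)
    fix i j assume "i < dim_row C" "j < dim_col C"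
    then have "i \<in> (\<lambda>i. p (Suc i) - 1) ` {..<m}" "j \<in> (\<lambda>i. p (Suc i) - 1) ` {..<m}"
      using C bij_betw_shift_permutation[OF p] by (auto simp: bij_betw_def)
    then obtain a b where "a < m" "b < m" "i = p (Suc a) - 1" "j = p (Suc b) - 1" by auto
    then show "simul_perm m p C $$ (i, j) = C $$ (i, j)"
      using simul_perm_index[OF p C] * by simp
  qed (use C in \<open>auto simp: simul_perm_def\<close>)
qed

text \<open>Entries of a packed matrix are pairs, so invariance is one condition per component, and
  the injective packing turns the fixed set into a product. Only the second factor depends on
  \<open>n\<close>.\<close>

lemma card_fixed_weighted_matrices:
  assumes p: "p permutes {1..m}"
  defines "q \<equiv> \<lambda>a. p (Suc a) - 1"
  shows "card {C \<in> weighted_matrices S k m n. simul_perm m p C = C} =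
    card {B \<in> twin_free_rank_matrices S k m. \<forall>a<m. \<forall>b<m. B $$ (q a, q b) = B $$ (a, b)} *
    card {f \<in> compositions m n. \<forall>a<m. f (q a) = f a}"
proof -
  let ?T = "{B \<in> twin_free_rank_matrices S k m. \<forall>a<m. \<forall>b<m. B $$ (q a, q b) = B $$ (a, b)}"
  let ?F = "{f \<in> compositions m n. \<forall>a<m. f (q a) = f a}"
  have qlt: "q a < m" if "a < m" for a
    using bij_betw_shift_permutation[OF p] that by (auto simp: q_def bij_betw_def)
  have fixed: "simul_perm m p (weighted m B f) = weighted m B f \<longleftrightarrow>
      (\<forall>a<m. \<forall>b<m. B $$ (q a, q b) = B $$ (a, b)) \<and> (\<forall>a<m. f (q a) = f a)" for B :: "'a mat" and f
  proof -
    have "simul_perm m p (weighted m B f) = weighted m B f \<longleftrightarrow>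
        (\<forall>a<m. \<forall>b<m. weighted m B f $$ (q a, q b) = weighted m B f $$ (a, b))"
      unfolding q_def by (rule simul_perm_fixed_iff[OF p weighted_carrier])
    then show ?thesis using qlt by auto
  qed
  have "{C \<in> weighted_matrices S k m n. simul_perm m p C = C} =
      (\<lambda>(B, f). weighted m B f) ` (?T \<times> ?F)"
    by (auto simp: weighted_matrices_def fixed)
  moreover have "inj_on (\<lambda>(B, f). weighted m B f) (?T \<times> ?F)"
    by (rule inj_on_subset[OF inj_on_weighted])
      (auto simp: twin_free_rank_matrices_def rank_matrices_def compositions_def PiE_iff)
  ultimately show ?thesis
    by (simp add: card_image card_cartesian_product)
qed

text \<open>By Burnside's lemma the count is an average, over a group independent of
  \<open>n\<close>, of constants \<open>cT p\<close> times eventually quasipolynomial functions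
  \<open>cF p\<close>.\<close>

lemma eventually_quasipoly_card_weighted_orbits:
  assumes finS: "finite S"
  shows "eventually_quasipoly
    (\<lambda>n. real (card (orbits (sym_group m) (weighted_matrices S k m n) (simul_perm m))))"
proof -
  let ?G = "sym_group m"
  define q where "q p a = p (Suc a) - 1" for p :: "nat \<Rightarrow> nat" and a
  define cT where "cT p =
    card {B \<in> twin_free_rank_matrices S k m. \<forall>a<m. \<forall>b<m. B $$ (q p a, q p b) = B $$ (a, b)}" for p
  define cF where "cF p n = card {f \<in> compositions m n. \<forall>a<m. f (q p a) = f a}" for p n
  have pos: "Coset.order ?G > 0"
    by (simp add: Coset.order_def sym_group_card_carrier)
  then have finG: "finite (carrier ?G)"
    by (simp add: Coset.order_def card_ge_0_finite)
  have "real (card (orbits ?G (weighted_matrices S k m n) (simul_perm m))) =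
      (1 / real (Coset.order ?G)) * (\<Sum>p\<in>carrier ?G. real (cT p) * real (cF p n))" for n
  proof -
    have "card (orbits ?G (weighted_matrices S k m n) (simul_perm m)) * Coset.order ?G =
        (\<Sum>p\<in>carrier ?G. card {C \<in> weighted_matrices S k m n. simul_perm m p C = C})"
    proof (rule group_action.burnside_invariant_subset[OF simul_perm_group_action])
      show "weighted_matrices S k m n \<subseteq> carrier_mat m m"
        by (auto simp: weighted_matrices_def)
      show "finite (weighted_matrices S k m n)"
        unfolding weighted_matrices_def
        by (intro finite_imageI finite_cartesian_product finite_twin_free_rank_matrices[OF finS]
            finite_compositions)
    qed (use finG in \<open>auto simp: sym_group_carrier intro: simul_perm_weighted_matrices\<close>)
    also have "\<dots> = (\<Sum>p\<in>carrier ?G. cT p * cF p n)"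
      by (intro sum.cong refl) (simp add: card_fixed_weighted_matrices cT_def cF_def q_def sym_group_carrier)
    finally have "real (card (orbits ?G (weighted_matrices S k m n) (simul_perm m)) * Coset.order ?G) =
        real (\<Sum>p\<in>carrier ?G. cT p * cF p n)"
      by (rule arg_cong)
    then show ?thesis using pos by (simp add: field_simps)
  qed
  moreover have "eventually_quasipoly (\<lambda>n. real (cF p n))" if "p \<in> carrier ?G" for p
  proof -
    have p: "p permutes {1..m}" using that by (simp add: sym_group_carrier)
    have "q p \<in> {..<m} \<rightarrow> {..<m}"
      using bij_betw_shift_permutation[OF p] by (auto simp: q_def bij_betw_def)
    moreover have "{f \<in> compositions m n. \<forall>a<m. f (q p a) = f a} =
        {f \<in> {..<m} \<rightarrow>\<^sub>E {1..}. (\<forall>a\<in>{..<m}. f (q p a) = f a) \<and> (\<Sum>a\<in>{..<m}. f a) = n}" for n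
      by (auto simp: compositions_def)
    ultimately show ?thesis
      unfolding cF_def using eventually_quasipoly_card_invariant_compositions[of "{..<m}" "q p"]
      by simp
  qed
  ultimately show ?thesis
    by (simp only:) (intro eventually_quasipoly_cmult eventually_quasipoly_sum)
qed

text \<open>Both sides are sizes of images of the set \<open>Z\<close> of matrices paired with their
  reductions: one map takes the orbit of the matrix, the other that of the weighted reduction. The
  maps identify the same elements of \<open>Z\<close>, so their images are equally large.\<close>

lemma card_orbits_rank_matrices:
  fixes S :: "'a::field set"
  assumes finS: "finite S"
  shows "card (orbits (sym_group n) (rank_matrices S k n) (simul_perm n)) =
    (\<Sum>m\<le>card S ^ k * Suc (card S) ^ (card S ^ k).
      card (orbits (sym_group m) (weighted_matrices S k m n) (simul_perm m)))"
proof -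
  let ?N = "card S ^ k * Suc (card S) ^ (card S ^ k)"
  define Y where "Y = (SIGMA m:{..?N}. twin_free_rank_matrices S k m \<times> compositions m n)"
  define Z where "Z = {(A, m, B, f). A \<in> rank_matrices S k n \<and> (m, B, f) \<in> Y \<and> (\<exists>s. blowup n A m B f s)}"
  let ?F = "\<lambda>(A, m, B, f). orbit (sym_group n) (simul_perm n) A"
  \<comment> \<open>Keeping \<open>m\<close> holds the orbits for different sizes apart, so that
    cardinalities add up over \<open>m\<close>.\<close>
  let ?G = "\<lambda>(A, m, B, f). (m, orbit (sym_group m) (simul_perm m) (weighted m B f))"
  have "finite Y"
    unfolding Y_def
    by (intro finite_SigmaI finite_cartesian_product finite_twin_free_rank_matrices[OF finS]
        finite_compositions) simp
  moreover have "Z \<subseteq> rank_matrices S k n \<times> Y" by (auto simp: Z_def)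
  ultimately have finZ: "finite Z"
    using finite_rank_matrices[OF finS] finite_subset by blast
  have FG: "?F x = ?F y \<longleftrightarrow> ?G x = ?G y" if xZ: "x \<in> Z" and yZ: "y \<in> Z" for x y
  proof -
    obtain A m B f s where x: "x = (A, m, B, f)" "A \<in> rank_matrices S k n"
      "B \<in> twin_free_rank_matrices S k m" "blowup n A m B f s"
      using xZ by (auto simp: Z_def Y_def)
    obtain A' m' B' f' s' where y: "y = (A', m', B', f')" "A' \<in> rank_matrices S k n"
      "B' \<in> twin_free_rank_matrices S k m'" "blowup n A' m' B' f' s'"
      using yZ by (auto simp: Z_def Y_def)
    have tf: "twin_free m B" "twin_free m' B'"
      using x(3) y(3) by (simp_all add: twin_free_rank_matrices_def)
    have car: "A \<in> carrier_mat n n" "A' \<in> carrier_mat n n"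
      using x(2) y(2) by (simp_all add: rank_matrices_def)
    have "?F x = ?F y \<longleftrightarrow> m = m' \<and> (\<exists>\<pi>. bij_betw \<pi> {..<m} {..<m} \<and>
        (\<forall>a<m. \<forall>b<m. B' $$ (\<pi> a, \<pi> b) = B $$ (a, b)) \<and> (\<forall>a<m. f' (\<pi> a) = f a))"
      using orbit_simul_perm_eq_iff[OF car] blowup_orbit_iff[OF x(4) tf(1) y(4) tf(2)]
      by (simp add: x(1) y(1))
    also have "\<dots> \<longleftrightarrow> ?G x = ?G y"
      unfolding x(1) y(1) by (simp add: orbit_weighted_eq_iff cong: conj_cong)
    finally show ?thesis .
  qed
  have "card (?F ` Z) \<le> card (?G ` Z)"
    by (rule card_image_le_card_image[OF finZ]) (rule iffD2[OF FG])
  moreover have "card (?G ` Z) \<le> card (?F ` Z)"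
    by (rule card_image_le_card_image[OF finZ]) (rule iffD1[OF FG])
  ultimately have "card (?F ` Z) = card (?G ` Z)"
    by (rule order_antisym)
  moreover have "?F ` Z = orbits (sym_group n) (rank_matrices S k n) (simul_perm n)"
  proof -
    \<comment> \<open>Every matrix has a reduction, so the first map reaches all orbits.\<close>
    have "\<exists>m B f. (A, m, B, f) \<in> Z" if A: "A \<in> rank_matrices S k n" for A
    proof -
      obtain m B f s where "m \<le> ?N" "B \<in> twin_free_rank_matrices S k m" "f \<in> compositions m n"
        "blowup n A m B f s"
        by (rule exists_twin_free_reduction[OF A finS])
      then have "(A, m, B, f) \<in> Z" using A by (auto simp: Z_def Y_def)
      then show ?thesis by blast
    qed
    then have "fst ` Z = rank_matrices S k n"
      by (force simp: Z_def)
    moreover have "?F ` Z = orbit (sym_group n) (simul_perm n) ` (fst ` Z)"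
      unfolding image_image by (intro image_cong) auto
    ultimately show ?thesis by (auto simp: orbits_def)
  qed
  moreover have "?G ` Z = (SIGMA m:{..?N}. orbits (sym_group m) (weighted_matrices S k m n) (simul_perm m))"
  proof -
    \<comment> \<open>Every admissible pair has a blow-up, so the second map reaches all weighted
      orbits.\<close>
    have "\<exists>A. (A, m, B, f) \<in> Z" if Y: "(m, B, f) \<in> Y" for m B f
    proof -
      have "B \<in> rank_matrices S k m" "f \<in> compositions m n"
        using Y by (simp_all add: Y_def twin_free_rank_matrices_def)
      then obtain A s where "A \<in> rank_matrices S k n" "blowup n A m B f s"
        by (rule exists_blowup)
      then have "(A, m, B, f) \<in> Z" using Y by (auto simp: Z_def)
      then show ?thesis by blast
    qed
    then have "snd ` Z = Y"
      by (force simp: Z_def)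
    moreover have "?G ` Z = (\<lambda>(m, B, f). (m, orbit (sym_group m) (simul_perm m) (weighted m B f))) ` (snd ` Z)"
      unfolding image_image by (intro image_cong) auto
    ultimately show ?thesis
      by (auto simp: orbits_def weighted_matrices_def Y_def image_iff) blast
  qed
  moreover have "finite (orbits (sym_group m) (weighted_matrices S k m n) (simul_perm m))" for m
  proof -
    have "orbits (sym_group m) (weighted_matrices S k m n) (simul_perm m) =
      orbit (sym_group m) (simul_perm m) ` weighted_matrices S k m n"
      by (auto simp: orbits_def)
    then show ?thesis
      by (simp add: weighted_matrices_def finite_twin_free_rank_matrices[OF finS] finite_compositions)
  qed
  ultimately show ?thesis by (simp add: card_SigmaI)
qed

theorem corollary1p6:
  fixes S :: "'a::field set" and k :: nat
  assumes "finite S"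
  shows "\<exists>(f :: int \<Rightarrow> real) (n\<^sub>0 :: nat). quasipolynomial f \<and>
    (\<forall>n\<ge>n\<^sub>0. real (card (orbits (sym_group n) (rank_matrices S k n) (simul_perm n))) = f (int n))"
proof (rule eventually_quasipoly_imp_quasipolynomial)
  \<comment> \<open>The range of the sum over \<open>m\<close> does not depend on \<open>n\<close>,
    so closure under finite sums suffices.\<close>
  show "eventually_quasipoly
      (\<lambda>n. real (card (orbits (sym_group n) (rank_matrices S k n) (simul_perm n))))"
    unfolding card_orbits_rank_matrices[OF assms] of_nat_sum
    using eventually_quasipoly_card_weighted_orbits[OF assms] by (intro eventually_quasipoly_sum)
qed

end
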